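(* Let $G$ be a connected, locally finite, transitive graph with critical point for site percolation $p_c=p_c(G)<1$, and suppose that there can be at most one infinite cluster on $G$ (i.e. for each $p\in[0,1]$, site percolation on $G$ with parameter $p$ has almost surely at most one infinite occupied cluster). Fix an arbitrary $v\in V(G)$ and let $\eta$ be the time till the first burnout of $v$ in the forest fire model on $G$ with ignition only at the origin $v_0\in V(G)$. Then for any $p\in(p_c,1)$, $$\mathbb{P}(\eta>x)\le \gamma^{-1}\left[x(1-p)+1\right]e^{-\lambda x}\qquad\text{for all } x>0,$$ where $$\gamma=1-\frac{\theta(p)^2}{p}\in(0,1),$$ and $\lambda=\lambda(\gamma)>0$ is the smallest positive solution of $\phi(\lambda)=\gamma^{-1}$ with $$\phi(t)=\left[1-\frac{t}{(1-p)^{1-t}}\right]^{-1}.$$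
   Context: Forest fire model on a connected locally finite graph $G$ with vertex set $V(G)$ and a special vertex $v_0\in V(G)$ (the origin): each site $x$ has state $\eta_x(t)\in\{0,1\}$ at time $t\ge0$ (0 = vacant, 1 = occupied); at time $0$ all sites are vacant. Each vacant site becomes occupied at rate $1$, independently for different sites (independent rate-1 Poisson arrivals); it remains occupied until it is burnt out, which makes it vacant again. Only $v_0$ is constantly hit by lightning: whenever $v_0$ becomes occupied, all sites in the cluster (connected component) of occupied sites containing $v_0$, including $v_0$, are instantaneously burnt out. A graph is transitive if $G$ viewed from any vertex is isomorphic to $G$ viewed from $v_0$ (for every $v\in V(G)$ there is an automorphism of $G$ taking $v_0$ to $v$). In site percolation with parameter $p$ each site is independently occupied with probability $p$; $\theta(p)$ is the probability that $v_0$ belongs to an infinite cluster of occupied sites, and $p_c=\sup\{p:\theta(p)=0\}$. *)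

theory Defs
  imports "HOL-Probability.Probability"
begin

section \<open>Graphs\<close>

definition simple_graph :: "'v set \<Rightarrow> ('v \<Rightarrow> 'v \<Rightarrow> bool) \<Rightarrow> bool" where
  "simple_graph V E \<longleftrightarrow>
     (\<forall>x y. E x y \<longrightarrow> x \<in> V \<and> y \<in> V) \<and> (\<forall>x y. E x y \<longrightarrow> E y x) \<and> (\<forall>x. \<not> E x x)"

definition graph_connected :: "'v set \<Rightarrow> ('v \<Rightarrow> 'v \<Rightarrow> bool) \<Rightarrow> bool" where
  "graph_connected V E \<longleftrightarrow> (\<forall>x\<in>V. \<forall>y\<in>V. E\<^sup>*\<^sup>* x y)"

definition graph_locally_finite :: "'v set \<Rightarrow> ('v \<Rightarrow> 'v \<Rightarrow> bool) \<Rightarrow> bool" where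
  "graph_locally_finite V E \<longleftrightarrow> (\<forall>x\<in>V. finite {y. E x y})"

definition graph_automorphism :: "'v set \<Rightarrow> ('v \<Rightarrow> 'v \<Rightarrow> bool) \<Rightarrow> ('v \<Rightarrow> 'v) \<Rightarrow> bool" where
  "graph_automorphism V E f \<longleftrightarrow>
     bij_betw f V V \<and> (\<forall>x\<in>V. \<forall>y\<in>V. E (f x) (f y) \<longleftrightarrow> E x y)"

definition graph_transitive :: "'v set \<Rightarrow> ('v \<Rightarrow> 'v \<Rightarrow> bool) \<Rightarrow> 'v \<Rightarrow> bool" where
  "graph_transitive V E v0 \<longleftrightarrow> (\<forall>v\<in>V. \<exists>f. graph_automorphism V E f \<and> f v0 = v)"

text \<open>The connected component of \<open>x\<close> in the subgraph induced by the occupied set \<open>A\<close>;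
  it is empty when \<open>x\<close> is vacant.\<close>

definition cluster :: "('v \<Rightarrow> 'v \<Rightarrow> bool) \<Rightarrow> 'v set \<Rightarrow> 'v \<Rightarrow> 'v set" where
  "cluster E A x = {y. x \<in> A \<and> (\<lambda>a b. a \<in> A \<and> b \<in> A \<and> E a b)\<^sup>*\<^sup>* x y}"

definition clusters :: "('v \<Rightarrow> 'v \<Rightarrow> bool) \<Rightarrow> 'v set \<Rightarrow> 'v set set" where
  "clusters E A = cluster E A ` A"


section \<open>Site percolation\<close>

definition site_percolation :: "'v set \<Rightarrow> real \<Rightarrow> ('v \<Rightarrow> bool) measure" where
  "site_percolation V p = Pi\<^sub>M V (\<lambda>_. measure_pmf (bernoulli_pmf p))"

definition occupied_sites :: "'v set \<Rightarrow> ('v \<Rightarrow> bool) \<Rightarrow> 'v set" where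
  "occupied_sites V \<omega> = {x \<in> V. \<omega> x}"

definition percolation_prob :: "'v set \<Rightarrow> ('v \<Rightarrow> 'v \<Rightarrow> bool) \<Rightarrow> 'v \<Rightarrow> real \<Rightarrow> real" where
  "percolation_prob V E v0 p =
     measure (site_percolation V p)
       {\<omega> \<in> space (site_percolation V p). infinite (cluster E (occupied_sites V \<omega>) v0)}"

definition critical_point :: "'v set \<Rightarrow> ('v \<Rightarrow> 'v \<Rightarrow> bool) \<Rightarrow> 'v \<Rightarrow> real" where
  "critical_point V E v0 = Sup {p \<in> {0..1}. percolation_prob V E v0 p = 0}"

definition at_most_one_infinite_cluster :: "'v set \<Rightarrow> ('v \<Rightarrow> 'v \<Rightarrow> bool) \<Rightarrow> bool" where
  "at_most_one_infinite_cluster V E \<longleftrightarrow>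
     (\<forall>p\<in>{0..1}. AE \<omega> in site_percolation V p.
        \<exists>\<^sub>\<le>\<^sub>1 C. C \<in> clusters E (occupied_sites V \<omega>) \<and> infinite C)"


section \<open>Poisson arrivals\<close>

text \<open>A rate-1 Poisson process is given by its i.i.d. standard exponential gaps:
  \<open>X x n\<close> is the gap between the \<open>n\<close>-th and the \<open>(n+1)\<close>-st arrival at the site \<open>x\<close>, where
  the \<open>0\<close>-th arrival is the time origin and not an actual arrival.\<close>

definition poisson_arrivals :: "'w measure \<Rightarrow> 'v set \<Rightarrow> ('v \<Rightarrow> nat \<Rightarrow> 'w \<Rightarrow> real) \<Rightarrow> bool" where
  "poisson_arrivals M V X \<longleftrightarrow>
     prob_space M \<and>
     prob_space.indep_vars M (\<lambda>_. borel) (\<lambda>(x, n). X x n) (V \<times> UNIV) \<and>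
     (\<forall>x\<in>V. \<forall>n. distributed M lborel (X x n) (exponential_density 1))"

definition arrival_time :: "('v \<Rightarrow> nat \<Rightarrow> 'w \<Rightarrow> real) \<Rightarrow> 'w \<Rightarrow> 'v \<Rightarrow> nat \<Rightarrow> real" where
  "arrival_time X \<omega> x n = (\<Sum>k<n. X x k \<omega>)"


section \<open>Forest fire with ignition only at the origin\<close>

text \<open>The dynamics is a deterministic function of the arrival times \<open>T x n\<close> (with \<open>n \<ge> 1\<close>).
  An arrival at an occupied site has no effect.  Since \<open>v0\<close> burns as soon as it becomes
  occupied, it is vacant before each of its arrivals, so the fires occur exactly at the times
  \<open>T v0 1 < T v0 2 < \<dots>\<close>, and the process is built by recursion on their number.\<close>

definition sites_hit :: "'v set \<Rightarrow> ('v \<Rightarrow> nat \<Rightarrow> real) \<Rightarrow> real \<Rightarrow> real \<Rightarrow> 'v set" where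
  "sites_hit V T s t = {x \<in> V. \<exists>n\<ge>1. s < T x n \<and> T x n \<le> t}"

text \<open>\<open>ff_after V E v0 T k\<close> is the set of occupied sites immediately after the \<open>k\<close>-th fire
  (at time 0 if \<open>k = 0\<close>).\<close>

primrec ff_after ::
  "'v set \<Rightarrow> ('v \<Rightarrow> 'v \<Rightarrow> bool) \<Rightarrow> 'v \<Rightarrow> ('v \<Rightarrow> nat \<Rightarrow> real) \<Rightarrow> nat \<Rightarrow> 'v set" where
  "ff_after V E v0 T 0 = {}"
| "ff_after V E v0 T (Suc k) =
     (let A = ff_after V E v0 T k \<union> sites_hit V T (T v0 k) (T v0 (Suc k)) in A - cluster E A v0)"

text \<open>\<open>ff_burnt V E v0 T k\<close> is the set of sites burnt out at time \<open>T v0 (Suc k)\<close>.\<close>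

definition ff_burnt ::
  "'v set \<Rightarrow> ('v \<Rightarrow> 'v \<Rightarrow> bool) \<Rightarrow> 'v \<Rightarrow> ('v \<Rightarrow> nat \<Rightarrow> real) \<Rightarrow> nat \<Rightarrow> 'v set" where
  "ff_burnt V E v0 T k =
     cluster E (ff_after V E v0 T k \<union> sites_hit V T (T v0 k) (T v0 (Suc k))) v0"

text \<open>The value is \<open>\<infinity>\<close> if \<open>v\<close> never burns.\<close>

definition first_burnout ::
  "'v set \<Rightarrow> ('v \<Rightarrow> 'v \<Rightarrow> bool) \<Rightarrow> 'v \<Rightarrow> ('v \<Rightarrow> nat \<Rightarrow> real) \<Rightarrow> 'v \<Rightarrow> ereal" where
  "first_burnout V E v0 T v = (INF k\<in>{k. v \<in> ff_burnt V E v0 T k}. ereal (T v0 (Suc k)))"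

text \<open>The set of occupied sites at time \<open>t\<close>, and the facts showing that it follows the
  forest fire dynamics: all sites are vacant at time 0, between two fires exactly the sites with
  an arrival are added, and at each fire the cluster of \<open>v0\<close> (which has just become occupied)
  is removed.\<close>

definition ff_occupied ::
  "'v set \<Rightarrow> ('v \<Rightarrow> 'v \<Rightarrow> bool) \<Rightarrow> 'v \<Rightarrow> ('v \<Rightarrow> nat \<Rightarrow> real) \<Rightarrow> real \<Rightarrow> 'v set" where
  "ff_occupied V E v0 T t =
     {x. \<exists>k. T v0 k \<le> t \<and> t < T v0 (Suc k) \<and> x \<in> ff_after V E v0 T k \<union> sites_hit V T (T v0 k) t}"

lemma ff_occupied_between:
  assumes "strict_mono (T v0)" "T v0 k \<le> t" "t < T v0 (Suc k)"
  shows "ff_occupied V E v0 T t = ff_after V E v0 T k \<union> sites_hit V T (T v0 k) t"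
proof -
  have "j = k" if "T v0 j \<le> t" "t < T v0 (Suc j)" for j
  proof -
    have "T v0 j < T v0 (Suc k)" "T v0 k < T v0 (Suc j)"
      using that assms(2,3) by linarith+
    then show ?thesis
      using assms(1) by (simp add: strict_mono_less)
  qed
  with assms(2,3) show ?thesis
    unfolding ff_occupied_def by blast
qed

lemma ff_occupied_start:
  assumes "strict_mono (T v0)" "T v0 0 = 0"
  shows "ff_occupied V E v0 T 0 = {}"
proof -
  have "0 < T v0 (Suc 0)"
    using assms strict_monoD[of "T v0" 0 "Suc 0"] by simp
  then show ?thesis
    using ff_occupied_between[of T v0 0 0 V E] assms by (auto simp: sites_hit_def)
qed

lemma ff_occupied_growth:
  assumes "strict_mono (T v0)" "T v0 k \<le> s" "s \<le> t" "t < T v0 (Suc k)"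
  shows "ff_occupied V E v0 T t = ff_occupied V E v0 T s \<union> sites_hit V T s t"
proof -
  have "sites_hit V T (T v0 k) t = sites_hit V T (T v0 k) s \<union> sites_hit V T s t"
    using assms(2,3) unfolding sites_hit_def by force
  moreover have "ff_occupied V E v0 T t = ff_after V E v0 T k \<union> sites_hit V T (T v0 k) t"
    using assms by (intro ff_occupied_between) auto
  moreover have "ff_occupied V E v0 T s = ff_after V E v0 T k \<union> sites_hit V T (T v0 k) s"
    using assms by (intro ff_occupied_between) auto
  ultimately show ?thesis by blast
qed

lemma ff_occupied_fire:
  fixes V :: "'v set" and E :: "'v \<Rightarrow> 'v \<Rightarrow> bool"
  assumes "strict_mono (T v0)" "T v0 k \<le> s" "s < T v0 (Suc k)"
  defines "A \<equiv> ff_occupied V E v0 T s \<union> sites_hit V T s (T v0 (Suc k))"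
  shows "ff_burnt V E v0 T k = cluster E A v0"
    and "ff_occupied V E v0 T (T v0 (Suc k)) = A - cluster E A v0"
    and "v0 \<in> V \<Longrightarrow> v0 \<in> A"
proof -
  have hit: "sites_hit V T (T v0 k) (T v0 (Suc k))
      = sites_hit V T (T v0 k) s \<union> sites_hit V T s (T v0 (Suc k))"
    using assms(2,3) unfolding sites_hit_def by force
  have A: "A = ff_after V E v0 T k \<union> sites_hit V T (T v0 k) (T v0 (Suc k))"
    unfolding A_def hit ff_occupied_between[of T v0 k s V E, OF assms(1-3)] by blast
  show "ff_burnt V E v0 T k = cluster E A v0"
    unfolding ff_burnt_def A ..
  have "T v0 (Suc k) < T v0 (Suc (Suc k))"
    using assms(1) by (simp add: strict_mono_less)
  then have "ff_occupied V E v0 T (T v0 (Suc k))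
      = ff_after V E v0 T (Suc k) \<union> sites_hit V T (T v0 (Suc k)) (T v0 (Suc k))"
    using assms(1) by (intro ff_occupied_between) auto
  also have "\<dots> = A - cluster E A v0"
    by (auto simp: A Let_def sites_hit_def)
  finally show "ff_occupied V E v0 T (T v0 (Suc k)) = A - cluster E A v0" .
  show "v0 \<in> A" if "v0 \<in> V"
    using that assms(3) unfolding A_def sites_hit_def by force
qed


section \<open>The function determining the rate of decay\<close>

definition ff_phi :: "real \<Rightarrow> real \<Rightarrow> real" where
  "ff_phi p t = inverse (1 - t / (1 - p) powr (1 - t))"

end

theory Submission
  imports Defs
begin

text \<open>
Since \<open>v0\<close> burns at each of its arrivals, the fires form a Poisson process, and the gaps between
them are independent standard exponential variables. Put \<open>d = - ln (1 - p)\<close>, so that a given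
site has an arrival during a period of length \<open>d\<close> with probability exactly \<open>p\<close>. Call a gap long
if it exceeds \<open>d\<close>, and in a long gap look only at its first \<open>d\<close> time units. Given the arrivals at
\<open>v0\<close>, the sites other than \<open>v0\<close> that are hit in these windows form independent copies of site
percolation with parameter \<open>p\<close>, one for each long gap. If \<open>v\<close> is connected to \<open>v0\<close> within such a
configuration together with \<open>v0\<close>, then the fire that ends the gap burns \<open>v\<close>.

The probability of this connection is at least \<open>\<theta>(p)\<^sup>2 / p = 1 - \<gamma>\<close> (\<open>connection_prob_ge\<close>):
by Harris' inequality and transitivity both \<open>v0\<close> and \<open>v\<close> lie in infinite clusters with
probability at least \<open>\<theta>(p)\<^sup>2\<close>, by uniqueness these clusters then coincide, and the division by
\<open>p\<close> is the conditioning on \<open>v0\<close> being occupied. Hence, given the arrivals at \<open>v0\<close>, the vertex \<open>v\<close>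
survives up to time \<open>x\<close> with probability at most \<open>\<gamma>\<close> to the number of long gaps completed by
time \<open>x\<close> (\<open>survival_given_origin_arrivals\<close>).

It remains to average over the gaps. A gap \<open>u\<close> contributes the weight \<open>w(u) = \<gamma>\<close> if \<open>u > d\<close> and
\<open>w(u) = 1\<close> otherwise. Summing the gaps up to and including a first long one gives a random time
with moment generating function \<open>\<phi>\<close>, and \<open>\<phi>(l) = 1 / \<gamma>\<close> is equivalent to the mean of
\<open>w(u) e\<^bsup>l u\<^esup>\<close> being \<open>1\<close> (\<open>nn_integral_tilted_weight\<close>). So the product of the weights, times
\<open>e\<^bsup>l S\<^esup>\<close> with \<open>S\<close> the sum of the gaps, is a martingale. Stopping it at the first gap that
passes \<open>x\<close> costs one factor \<open>\<gamma>\<close> and gives the bound \<open>\<gamma>\<^bsup>-1\<^esup> e\<^bsup>-l x\<^esup>\<close>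
(\<open>expected_failure_weight_le\<close>), which is at most the bound claimed, because \<open>x (1 - p) + 1 \<ge> 1\<close>.

The independence between windows and between sites rests on one computation: a Poisson process
avoids a finite union of disjoint windows with the probability \<open>e\<^bsup>-m\<^esup>\<close>, where \<open>m\<close> is their total
length (\<open>avoid_intervals_probability\<close>). Applied to all subfamilies of the windows, this says that
the events of having no arrival in the individual windows are independent.
\<close>

section \<open>Clusters of occupied sites\<close>

lemma cluster_mono:
  assumes "A \<subseteq> B"
  shows "cluster E A x \<subseteq> cluster E B x"
proof -
  have "(\<lambda>a b. a \<in> A \<and> b \<in> A \<and> E a b)\<^sup>*\<^sup>* x y \<Longrightarrow> (\<lambda>a b. a \<in> B \<and> b \<in> B \<and> E a b)\<^sup>*\<^sup>* x y" for y
    by (rule rtranclp_mono[THEN predicate2D, rotated]) (use assms in auto)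
  then show ?thesis
    using assms by (auto simp: cluster_def)
qed

lemma cluster_subset: "cluster E A x \<subseteq> A"
proof
  fix y assume y: "y \<in> cluster E A x"
  then have "(\<lambda>a b. a \<in> A \<and> b \<in> A \<and> E a b)\<^sup>*\<^sup>* x y" and x: "x \<in> A"
    by (auto simp: cluster_def)
  then show "y \<in> A"
    by (induction rule: rtranclp_induct) auto
qed

lemma cluster_self: "x \<in> A \<Longrightarrow> x \<in> cluster E A x"
  by (simp add: cluster_def)

lemma cluster_step: "y \<in> cluster E A x \<Longrightarrow> E y z \<Longrightarrow> z \<in> A \<Longrightarrow> z \<in> cluster E A x"
proof -
  assume y: "y \<in> cluster E A x" and "E y z" "z \<in> A"
  moreover have "y \<in> A" using y cluster_subset[of E A x] by blast
  ultimately show ?thesis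
    unfolding cluster_def
    by (auto intro!: rtranclp.rtrancl_into_rtrancl[where b = y])
qed

text \<open>The witness is the set of sites on a path. Requiring \<open>F \<subseteq> cluster E F x\<close> keeps witnesses
closed under unions, so that many sites of a cluster can be certified by a single finite set.\<close>

lemma cluster_finite_witness:
  assumes "y \<in> cluster E A x"
  shows "\<exists>F. finite F \<and> F \<subseteq> A \<and> y \<in> F \<and> F \<subseteq> cluster E F x"
proof -
  from assms have "(\<lambda>a b. a \<in> A \<and> b \<in> A \<and> E a b)\<^sup>*\<^sup>* x y" and x: "x \<in> A"
    by (auto simp: cluster_def)
  then show ?thesis
  proof (induction rule: rtranclp_induct)
    case base
    then show ?case
      by (intro exI[of _ "{x}"]) (auto intro: cluster_self)
  next
    case (step y z)
    then obtain F where F: "finite F" "F \<subseteq> A" "y \<in> F" "F \<subseteq> cluster E F x"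
      by auto
    have sub: "F \<subseteq> cluster E (insert z F) x"
      using F(4) cluster_mono[of F "insert z F" E x] by blast
    moreover have "z \<in> cluster E (insert z F) x"
    proof (rule cluster_step)
      show "y \<in> cluster E (insert z F) x" using sub F(3) by (rule subsetD)
    qed (use step(2) in simp_all)
    ultimately have "insert z F \<subseteq> cluster E (insert z F) x"
      by simp
    moreover have "finite (insert z F)" "insert z F \<subseteq> A"
      using F(1,2) step(2) by simp_all
    ultimately show ?case
      by (intro exI[of _ "insert z F"] conjI) simp_all
  qed
qed

lemma mem_cluster_iff_finite_subset:
  "y \<in> cluster E A x \<longleftrightarrow> (\<exists>F. finite F \<and> y \<in> cluster E F x \<and> F \<subseteq> A)"
proof
  assume "y \<in> cluster E A x"
  then obtain F where "finite F" "F \<subseteq> A" "y \<in> F" "F \<subseteq> cluster E F x"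
    using cluster_finite_witness[of y E A x] by auto
  then show "\<exists>F. finite F \<and> y \<in> cluster E F x \<and> F \<subseteq> A" by auto
next
  assume "\<exists>F. finite F \<and> y \<in> cluster E F x \<and> F \<subseteq> A"
  then obtain F where "y \<in> cluster E F x" "F \<subseteq> A" by auto
  then show "y \<in> cluster E A x" using cluster_mono[of F A E x] by auto
qed

text \<open>Connections and infinite clusters are described through finite occupied sets. This makes the
corresponding events measurable, and increasing limits of events that depend on finitely many
sites, which is the form in which Harris' inequality is proved.\<close>

lemma infinite_cluster_iff_finite_subsets:
  "infinite (cluster E A x) \<longleftrightarrow>
     (\<forall>n. \<exists>F. finite F \<and> F \<subseteq> cluster E F x \<and> n \<le> card F \<and> F \<subseteq> A)"
proof (intro iffI allI)
  fix n assume inf: "infinite (cluster E A x)"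
  obtain C where C: "C \<subseteq> cluster E A x" "finite C" "card C = n"
    using infinite_arbitrarily_large[OF inf] by blast
  have "\<forall>y\<in>C. \<exists>F. finite F \<and> F \<subseteq> A \<and> y \<in> F \<and> F \<subseteq> cluster E F x"
    using C(1) cluster_finite_witness[of _ E A x] by blast
  then obtain F where F: "\<And>y. y \<in> C \<Longrightarrow> finite (F y) \<and> F y \<subseteq> A \<and> y \<in> F y \<and> F y \<subseteq> cluster E (F y) x"
    by metis
  let ?F = "\<Union>y\<in>C. F y"
  have fin: "finite ?F" using C F by auto
  moreover have "?F \<subseteq> A" "C \<subseteq> ?F" using F by auto
  moreover have "n \<le> card ?F"
    using card_mono[OF fin \<open>C \<subseteq> ?F\<close>] C(3) by simp
  moreover have "?F \<subseteq> cluster E ?F x"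
  proof
    fix z assume "z \<in> ?F"
    then obtain y where y: "y \<in> C" "z \<in> F y" by blast
    then have "z \<in> cluster E (F y) x" using F by blast
    then show "z \<in> cluster E ?F x"
      using cluster_mono[of "F y" ?F E x] y(1) by blast
  qed
  ultimately show "\<exists>F. finite F \<and> F \<subseteq> cluster E F x \<and> n \<le> card F \<and> F \<subseteq> A"
    by blast
next
  assume *: "\<forall>n. \<exists>F. finite F \<and> F \<subseteq> cluster E F x \<and> n \<le> card F \<and> F \<subseteq> A"
  show "infinite (cluster E A x)"
  proof
    assume fin: "finite (cluster E A x)"
    obtain F where F: "F \<subseteq> cluster E F x" "Suc (card (cluster E A x)) \<le> card F" "F \<subseteq> A"
      using * by blast
    have "F \<subseteq> cluster E A x" using F(1) cluster_mono[OF F(3), of E x] by blast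
    from card_mono[OF fin this] F(2) show False by simp
  qed
qed

text \<open>The automorphism maps paths to paths and is injective, so it embeds one cluster into the other.\<close>

lemma infinite_cluster_automorphism:
  assumes f: "graph_automorphism V E f" and A: "A \<subseteq> V" and x: "x \<in> V"
    and inf: "infinite (cluster E {y \<in> V. f y \<in> A} x)"
  shows "infinite (cluster E A (f x))"
proof -
  let ?B = "{y \<in> V. f y \<in> A}"
  have "f y \<in> cluster E A (f x)" if "y \<in> cluster E ?B x" for y
  proof -
    from that have "(\<lambda>a b. a \<in> ?B \<and> b \<in> ?B \<and> E a b)\<^sup>*\<^sup>* x y" and xB: "x \<in> ?B"
      by (auto simp: cluster_def)
    then show ?thesis
    proof (induction rule: rtranclp_induct)
      case base
      then show ?case by (auto intro: cluster_self)
    next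
      case (step y z)
      then show ?case
        using f by (simp add: graph_automorphism_def cluster_step[of "f y"])
    qed
  qed
  then have sub: "f ` cluster E ?B x \<subseteq> cluster E A (f x)" by blast
  have "inj_on f V" using f by (simp add: graph_automorphism_def bij_betw_def)
  then have "inj_on f (cluster E ?B x)"
    by (rule inj_on_subset) (use cluster_subset[of E ?B x] in blast)
  then have "infinite (f ` cluster E ?B x)" using inf by (simp add: finite_image_iff)
  then show ?thesis using sub finite_subset by blast
qed

lemma countable_connected_locally_finite:
  assumes "simple_graph V E" "graph_connected V E" "graph_locally_finite V E" "v0 \<in> V"
  shows "countable V"
proof -
  \<comment> \<open>the sites joined to \<open>v0\<close> by a walk of exactly \<open>n\<close> steps\<close>
  define B where "B = rec_nat {v0} (\<lambda>_ A. \<Union>x\<in>A. {y. E x y})"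
  have B0: "B 0 = {v0}" and BS: "B (Suc n) = (\<Union>x\<in>B n. {y. E x y})" for n
    by (auto simp: B_def)
  have fin: "finite (B n) \<and> B n \<subseteq> V" for n
  proof (induction n)
    case (Suc n)
    then show ?case
      using assms unfolding BS simple_graph_def graph_locally_finite_def by auto
  qed (use B0 assms in auto)
  have "\<exists>n. x \<in> B n" if "E\<^sup>*\<^sup>* v0 x" for x
    using that
  proof (induction rule: rtranclp_induct)
    case base then show ?case using B0 by auto
  next
    case (step y z) 
    then obtain n where "y \<in> B n" by auto
    then have "z \<in> B (Suc n)" using step BS by auto
    then show ?case by blast
  qed
  then have "V \<subseteq> (\<Union>n. B n)"
    using assms unfolding graph_connected_def by blast
  moreover have "countable (\<Union>n. B n)" using fin by (auto intro: countable_finite)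
  ultimately show ?thesis by (rule countable_subset)
qed

section \<open>Site percolation and Harris' inequality\<close>

definition contains_some :: "'v set \<Rightarrow> real \<Rightarrow> 'v set set \<Rightarrow> ('v \<Rightarrow> bool) set" where
  "contains_some V p \<F> = {\<omega> \<in> space (site_percolation V p). \<exists>F\<in>\<F>. F \<subseteq> occupied_sites V \<omega>}"

lemma prob_space_site_percolation: "prob_space (site_percolation V p)"
  unfolding site_percolation_def by (intro prob_space_PiM measure_pmf.prob_space_axioms)

lemma space_site_percolation: "space (site_percolation V p) = PiE V (\<lambda>_. UNIV)"
  by (simp add: site_percolation_def space_PiM)

lemma sets_contains_some:
  assumes "countable V" "\<F> \<subseteq> {F. finite F \<and> F \<subseteq> V}"
  shows "contains_some V p \<F> \<in> sets (site_percolation V p)"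
proof -
  have "countable {F. finite F \<and> F \<subseteq> V}"
    by (rule countable_Collect_finite_subset) fact
  then have "countable \<F>" using assms(2) countable_subset by blast
  moreover have "contains_some V p \<F>
      = (\<Union>F\<in>\<F>. {\<omega> \<in> space (site_percolation V p). \<forall>x\<in>F. \<omega> x})"
    using assms(2) by (auto simp: contains_some_def occupied_sites_def subset_iff)
  moreover have "{\<omega> \<in> space (site_percolation V p). \<forall>x\<in>F. \<omega> x} \<in> sets (site_percolation V p)"
    if "F \<in> \<F>" for F
  proof (rule sets.sets_Collect_finite_All)
    fix x assume "x \<in> F"
    then have "x \<in> V" using that assms(2) by blast
    then show "{\<omega> \<in> space (site_percolation V p). \<omega> x} \<in> sets (site_percolation V p)"
      unfolding site_percolation_def by (intro sets_Collect_single') auto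
  qed (use that assms(2) in auto)
  ultimately show ?thesis by (auto intro!: sets.countable_UN')
qed

text \<open>The expectation of \<open>f\<close> applied to the random subset of \<open>S\<close> that contains each site independently
with probability \<open>p\<close>.\<close>

definition bernoulli_sum :: "real \<Rightarrow> 'v set \<Rightarrow> ('v set \<Rightarrow> real) \<Rightarrow> real" where
  "bernoulli_sum p S f = (\<Sum>A\<in>Pow S. p ^ card A * (1 - p) ^ card (S - A) * f A)"

lemma bernoulli_sum_insert:
  assumes "finite S" "x \<notin> S"
  shows "bernoulli_sum p (insert x S) f
    = p * bernoulli_sum p S (\<lambda>A. f (insert x A)) + (1 - p) * bernoulli_sum p S f"
proof -
  let ?w = "\<lambda>A. p ^ card A * (1 - p) ^ card (insert x S - A) * f A"
  have "bernoulli_sum p (insert x S) f = sum ?w (Pow S) + sum ?w (insert x ` Pow S)"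
    unfolding bernoulli_sum_def Pow_insert using assms by (intro sum.union_disjoint) auto
  also have "sum ?w (Pow S) = (1 - p) * bernoulli_sum p S f"
    unfolding bernoulli_sum_def sum_distrib_left
  proof (intro sum.cong refl)
    fix A assume "A \<in> Pow S"
    then have "insert x S - A = insert x (S - A)" using assms by auto
    then have "card (insert x S - A) = Suc (card (S - A))" using assms by simp
    then show "?w A = (1 - p) * (p ^ card A * (1 - p) ^ card (S - A) * f A)" by simp
  qed
  also have "sum ?w (insert x ` Pow S) = (\<Sum>A\<in>Pow S. ?w (insert x A))"
    by (rule sum.reindex_cong[of "insert x" _ _ ]) (use assms in \<open>auto simp: inj_on_def\<close>)
  also have "\<dots> = p * bernoulli_sum p S (\<lambda>A. f (insert x A))"
    unfolding bernoulli_sum_def sum_distrib_left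
  proof (intro sum.cong refl)
    fix A assume A: "A \<in> Pow S"
    then have "finite A" "x \<notin> A" using assms finite_subset[of A S] by auto
    then have "card (insert x A) = Suc (card A)" by simp
    moreover have "insert x S - insert x A = S - A" using A assms by auto
    ultimately show "?w (insert x A) = p * (p ^ card A * (1 - p) ^ card (S - A) * f (insert x A))"
      by simp
  qed
  finally show ?thesis by simp
qed

lemma bernoulli_sum_mono:
  assumes "0 \<le> p" "p \<le> 1" "\<And>A. A \<subseteq> S \<Longrightarrow> f A \<le> g A"
  shows "bernoulli_sum p S f \<le> bernoulli_sum p S g"
  unfolding bernoulli_sum_def using assms by (intro sum_mono mult_left_mono) auto

text \<open>Induction on the sites. Conditioning on the new site splits each expectation into two; by
monotonicity, both functions have the larger expectation when the site is occupied, and two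
functions on two points that increase in the same direction are positively correlated.\<close>

lemma harris_bernoulli_sum:
  assumes p: "0 \<le> p" "p \<le> 1" and "finite S"
    and "\<And>A B. A \<subseteq> B \<Longrightarrow> B \<subseteq> S \<Longrightarrow> f A \<le> f B"
    and "\<And>A B. A \<subseteq> B \<Longrightarrow> B \<subseteq> S \<Longrightarrow> g A \<le> g B"
  shows "bernoulli_sum p S f * bernoulli_sum p S g \<le> bernoulli_sum p S (\<lambda>A. f A * g A)"
  using assms(3-5)
proof (induction S arbitrary: f g rule: finite_induct)
  case empty
  then show ?case by (simp add: bernoulli_sum_def)
next
  case (insert x S)
  let ?E = "bernoulli_sum p S"
  let ?f = "\<lambda>A. f (insert x A)" and ?g = "\<lambda>A. g (insert x A)"
  have 1: "?E ?f * ?E ?g \<le> ?E (\<lambda>A. ?f A * ?g A)"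
    by (rule insert.IH) (auto intro!: insert.prems)
  have 0: "?E f * ?E g \<le> ?E (\<lambda>A. f A * g A)"
    by (rule insert.IH) (auto intro!: insert.prems)
  have f: "?E f \<le> ?E ?f" using p by (intro bernoulli_sum_mono insert.prems) auto
  have g: "?E g \<le> ?E ?g" using p by (intro bernoulli_sum_mono insert.prems) auto
  have "0 \<le> p * (1 - p) * ((?E ?f - ?E f) * (?E ?g - ?E g))"
    using p f g by simp
  then have "(p * ?E ?f + (1 - p) * ?E f) * (p * ?E ?g + (1 - p) * ?E g)
      \<le> p * (?E ?f * ?E ?g) + (1 - p) * (?E f * ?E g)"
    by (simp add: algebra_simps)
  also have "\<dots> \<le> p * ?E (\<lambda>A. ?f A * ?g A) + (1 - p) * ?E (\<lambda>A. f A * g A)"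
    using p 0 1 by (intro add_mono mult_left_mono) auto
  finally show ?case
    using insert.hyps by (simp add: bernoulli_sum_insert)
qed

lemma percolation_finite_marginal:
  assumes p: "0 \<le> p" "p \<le> 1" and S: "finite S" "S \<subseteq> V"
  shows "measure (site_percolation V p) {\<omega> \<in> space (site_percolation V p). Q {x \<in> S. \<omega> x}}
    = bernoulli_sum p S (\<lambda>A. of_bool (Q A))"
proof -
  let ?P = "site_percolation V p"
  interpret P: product_prob_space "\<lambda>_::'a. measure_pmf (bernoulli_pmf p)" V
    by unfold_locales
  interpret P': prob_space ?P by (rule prob_space_site_percolation)
  define B where "B A = {\<omega> \<in> space ?P. {x \<in> S. \<omega> x} = A}" for A
  have emb: "B A = prod_emb V (\<lambda>_. measure_pmf (bernoulli_pmf p)) S (PiE S (\<lambda>x. {x \<in> A}))"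
    if "A \<subseteq> S" for A
    using that S by (auto simp: B_def prod_emb_def space_site_percolation PiE_iff extensional_def)
  have meas: "B A \<in> sets ?P" if "A \<subseteq> S" for A
    unfolding emb[OF that] site_percolation_def using S by (intro sets_PiM_I) auto
  have prob: "measure ?P (B A) = p ^ card A * (1 - p) ^ card (S - A)" if A: "A \<subseteq> S" for A
  proof -
    have "measure ?P (B A) = (\<Prod>x\<in>S. measure (measure_pmf (bernoulli_pmf p)) {x \<in> A})"
      unfolding emb[OF A] site_percolation_def using S by (intro P.measure_PiM_emb) auto
    also have "\<dots> = (\<Prod>x\<in>S. if x \<in> A then p else 1 - p)"
      using p by (intro prod.cong) (auto simp: measure_pmf_single)
    also have "\<dots> = p ^ card A * (1 - p) ^ card (S - A)"
      using S A by (simp add: prod.If_cases Int_absorb1 Diff_eq)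
    finally show ?thesis .
  qed
  have "{\<omega> \<in> space ?P. Q {x \<in> S. \<omega> x}} = (\<Union>A\<in>{A \<in> Pow S. Q A}. B A)"
    by (auto simp: B_def)
  also have "measure ?P \<dots> = (\<Sum>A\<in>{A \<in> Pow S. Q A}. measure ?P (B A))"
    using S meas by (intro P'.finite_measure_finite_Union) (auto simp: disjoint_family_on_def B_def)
  also have "\<dots> = (\<Sum>A\<in>Pow S. if Q A then p ^ card A * (1 - p) ^ card (S - A) else 0)"
    using S prob by (simp add: sum.inter_filter[symmetric])
  also have "\<dots> = bernoulli_sum p S (\<lambda>A. of_bool (Q A))"
    unfolding bernoulli_sum_def by (intro sum.cong) auto
  finally show ?thesis .
qed

lemma harris_contains_some_finite:
  assumes p: "0 \<le> p" "p \<le> 1"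
    and F: "finite \<F>" "\<F> \<subseteq> {F. finite F \<and> F \<subseteq> V}"
    and G: "finite \<G>" "\<G> \<subseteq> {F. finite F \<and> F \<subseteq> V}"
  shows "measure (site_percolation V p) (contains_some V p \<F>)
      * measure (site_percolation V p) (contains_some V p \<G>)
    \<le> measure (site_percolation V p) (contains_some V p \<F> \<inter> contains_some V p \<G>)"
proof -
  let ?P = "site_percolation V p"
  define S where "S = \<Union>\<F> \<union> \<Union>\<G>"
  have S: "finite S" "S \<subseteq> V" using F G by (auto simp: S_def)
  define f where "f \<H> A = (of_bool (\<exists>F\<in>\<H>. F \<subseteq> A) :: real)" for \<H> and A :: "'a set"
  have f_mono: "f \<H> A \<le> f \<H> B" if "A \<subseteq> B" for \<H> A B
    using that by (auto simp: f_def)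
  have occ: "F \<subseteq> occupied_sites V \<omega> \<longleftrightarrow> F \<subseteq> {x \<in> S. \<omega> x}" if "F \<in> \<F> \<union> \<G>" for F \<omega>
    using that S by (auto simp: occupied_sites_def S_def)
  have eqF: "contains_some V p \<F> = {\<omega> \<in> space ?P. \<exists>F\<in>\<F>. F \<subseteq> {x \<in> S. \<omega> x}}"
    using occ by (auto simp: contains_some_def)
  have eqG: "contains_some V p \<G> = {\<omega> \<in> space ?P. \<exists>F\<in>\<G>. F \<subseteq> {x \<in> S. \<omega> x}}"
    using occ by (auto simp: contains_some_def)
  have eqFG: "contains_some V p \<F> \<inter> contains_some V p \<G>
      = {\<omega> \<in> space ?P. (\<exists>F\<in>\<F>. F \<subseteq> {x \<in> S. \<omega> x}) \<and> (\<exists>F\<in>\<G>. F \<subseteq> {x \<in> S. \<omega> x})}"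
    unfolding eqF eqG by blast
  have "bernoulli_sum p S (f \<F>) * bernoulli_sum p S (f \<G>)
      \<le> bernoulli_sum p S (\<lambda>A. f \<F> A * f \<G> A)"
    using p S f_mono by (intro harris_bernoulli_sum) auto
  also have "(\<lambda>A. f \<F> A * f \<G> A) = (\<lambda>A. of_bool ((\<exists>F\<in>\<F>. F \<subseteq> A) \<and> (\<exists>F\<in>\<G>. F \<subseteq> A)))"
    by (auto simp: f_def)
  also have "bernoulli_sum p S \<dots> = measure ?P (contains_some V p \<F> \<inter> contains_some V p \<G>)"
    unfolding eqFG by (rule percolation_finite_marginal[symmetric]) fact+
  also have "bernoulli_sum p S (f \<F>) = measure ?P (contains_some V p \<F>)"
    unfolding eqF f_def by (rule percolation_finite_marginal[symmetric]) fact+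
  also have "bernoulli_sum p S (f \<G>) = measure ?P (contains_some V p \<G>)"
    unfolding eqG f_def by (rule percolation_finite_marginal[symmetric]) fact+
  finally show ?thesis .
qed

text \<open>A countable family is exhausted by finite subfamilies, and both sides are continuous along
increasing sequences of events.\<close>

lemma harris_contains_some:
  assumes p: "0 \<le> p" "p \<le> 1" and V: "countable V"
    and F: "\<F> \<subseteq> {F. finite F \<and> F \<subseteq> V}" and G: "\<G> \<subseteq> {F. finite F \<and> F \<subseteq> V}"
  shows "measure (site_percolation V p) (contains_some V p \<F>)
      * measure (site_percolation V p) (contains_some V p \<G>)
    \<le> measure (site_percolation V p) (contains_some V p \<F> \<inter> contains_some V p \<G>)"
proof (cases "\<F> = {} \<or> \<G> = {}")
  case True
  then show ?thesis by (auto simp: contains_some_def)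
next
  case False
  let ?P = "site_percolation V p"
  interpret prob_space ?P by (rule prob_space_site_percolation)
  have "countable {F. finite F \<and> F \<subseteq> V}"
    by (rule countable_Collect_finite_subset) fact
  then have c: "countable \<F>" "countable \<G>" using F G countable_subset by blast+
  define A where "A \<H> n = contains_some V p (from_nat_into \<H> ` {..<n})" for \<H> :: "'a set set" and n :: nat
  have into: "from_nat_into \<H> ` {..<n} \<subseteq> \<H>" if "\<H> \<noteq> {}" for \<H> :: "'a set set" and n :: nat
    using from_nat_into[OF that] by auto
  have sets: "A \<F> n \<in> sets ?P" "A \<G> n \<in> sets ?P" for n
    unfolding A_def using False
    by (auto intro!: sets_contains_some V subset_trans[OF into F] subset_trans[OF into G])
  have inc: "incseq (A \<H>)" for \<H>
    unfolding incseq_def A_def contains_some_def by fastforce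
  have Un: "(\<Union>n. A \<H> n) = contains_some V p \<H>" if "\<H> \<noteq> {}" "countable \<H>" for \<H>
  proof -
    have "(\<Union>n. from_nat_into \<H> ` {..<n}) = \<H>"
      using range_from_nat_into[OF that] by (simp add: image_UN[symmetric] UN_lessThan_UNIV)
    moreover have "(\<Union>n. contains_some V p (B n)) = contains_some V p (\<Union>n. B n)"
      for B :: "nat \<Rightarrow> 'a set set"
      by (auto simp: contains_some_def)
    ultimately show ?thesis
      unfolding A_def by simp
  qed
  have lim: "(\<lambda>n. measure ?P (A \<H> n)) \<longlonglongrightarrow> measure ?P (contains_some V p \<H>)"
    if "\<H> \<noteq> {}" "countable \<H>" "\<And>n. A \<H> n \<in> sets ?P" for \<H>
    unfolding Un[OF that(1,2), symmetric] using that(3) inc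
    by (intro finite_Lim_measure_incseq) auto
  have inc2: "incseq (\<lambda>n. A \<F> n \<inter> A \<G> n)"
    using inc[of \<F>] inc[of \<G>] unfolding incseq_def by blast
  have Un2: "(\<Union>n. A \<F> n \<inter> A \<G> n) = contains_some V p \<F> \<inter> contains_some V p \<G>"
  proof -
    have "(\<Union>n. A \<F> n \<inter> A \<G> n) = (\<Union>n. A \<F> n) \<inter> (\<Union>n. A \<G> n)"
    proof (intro equalityI subsetI)
      fix \<omega> assume "\<omega> \<in> (\<Union>n. A \<F> n) \<inter> (\<Union>n. A \<G> n)"
      then obtain m n where "\<omega> \<in> A \<F> m" "\<omega> \<in> A \<G> n" by auto
      then have "\<omega> \<in> A \<F> (max m n)" "\<omega> \<in> A \<G> (max m n)"
        using incseqD[OF inc[of \<F>], of m "max m n"] incseqD[OF inc[of \<G>], of n "max m n"]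
        by auto
      then show "\<omega> \<in> (\<Union>n. A \<F> n \<inter> A \<G> n)" by blast
    qed blast
    then show ?thesis using Un False c by simp
  qed
  have lim2: "(\<lambda>n. measure ?P (A \<F> n \<inter> A \<G> n))
      \<longlonglongrightarrow> measure ?P (contains_some V p \<F> \<inter> contains_some V p \<G>)"
    using finite_Lim_measure_incseq[of "\<lambda>n. A \<F> n \<inter> A \<G> n"] inc2 sets unfolding Un2 by auto
  have "measure ?P (A \<F> n) * measure ?P (A \<G> n) \<le> measure ?P (A \<F> n \<inter> A \<G> n)" for n
    unfolding A_def using p F G False into[of \<F> n] into[of \<G> n]
    by (intro harris_contains_some_finite) auto
  then show ?thesis
    using False c sets by (intro LIMSEQ_le[OF tendsto_mult[OF lim lim] lim2]) auto
qed

definition large_cluster_witnesses :: "'v set \<Rightarrow> ('v \<Rightarrow> 'v \<Rightarrow> bool) \<Rightarrow> 'v \<Rightarrow> nat \<Rightarrow> 'v set set" where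
  "large_cluster_witnesses V E x n
    = {F. finite F \<and> F \<subseteq> V \<and> F \<subseteq> cluster E F x \<and> n \<le> card F}"

text \<open>The events on the right decrease in \<open>n\<close>, and they are of the kind to which Harris' inequality
already applies; so it passes to infinite clusters by a decreasing limit.\<close>

lemma infinite_cluster_event:
  "{\<omega> \<in> space (site_percolation V p). infinite (cluster E (occupied_sites V \<omega>) x)}
    = (\<Inter>n. contains_some V p (large_cluster_witnesses V E x n))"
proof -
  have *: "\<omega> \<in> contains_some V p (large_cluster_witnesses V E x n) \<longleftrightarrow>
      \<omega> \<in> space (site_percolation V p) \<and>
      (\<exists>F. finite F \<and> F \<subseteq> cluster E F x \<and> n \<le> card F \<and> F \<subseteq> occupied_sites V \<omega>)" for \<omega> n
  proof -
    have "F \<subseteq> V" if "F \<subseteq> occupied_sites V \<omega>" for F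
      using that by (auto simp: occupied_sites_def)
    then show ?thesis
      unfolding contains_some_def large_cluster_witnesses_def by auto
  qed
  show ?thesis
    by (rule set_eqI) (simp add: * infinite_cluster_iff_finite_subsets)
qed

lemma sets_infinite_cluster:
  assumes "countable V"
  shows "{\<omega> \<in> space (site_percolation V p). infinite (cluster E (occupied_sites V \<omega>) x)}
    \<in> sets (site_percolation V p)"
proof -
  have "contains_some V p (large_cluster_witnesses V E x n) \<in> sets (site_percolation V p)" for n
    using assms by (intro sets_contains_some) (auto simp: large_cluster_witnesses_def)
  then show ?thesis unfolding infinite_cluster_event by blast
qed

lemma harris_infinite_clusters:
  fixes E :: "'v \<Rightarrow> 'v \<Rightarrow> bool" and V :: "'v set" and p :: real
  assumes p: "0 \<le> p" "p \<le> 1" and V: "countable V"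
  defines "I \<equiv> \<lambda>x. {\<omega> \<in> space (site_percolation V p). infinite (cluster E (occupied_sites V \<omega>) x)}"
  shows "measure (site_percolation V p) (I x) * measure (site_percolation V p) (I y)
      \<le> measure (site_percolation V p) (I x \<inter> I y)"
proof -
  let ?P = "site_percolation V p"
  interpret prob_space ?P by (rule prob_space_site_percolation)
  define A where "A x n = contains_some V p (large_cluster_witnesses V E x n)" for x n
  have I: "I x = (\<Inter>n. A x n)" for x
    unfolding I_def A_def by (rule infinite_cluster_event)
  have wit: "large_cluster_witnesses V E x n \<subseteq> {F. finite F \<and> F \<subseteq> V}" for x n
    by (auto simp: large_cluster_witnesses_def)
  have sets: "A x n \<in> sets ?P" for x n
    unfolding A_def by (intro sets_contains_some V wit)
  have dec: "decseq (A x)" for x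
    unfolding decseq_def A_def contains_some_def large_cluster_witnesses_def
    by (auto intro: order_trans)
  have lim: "(\<lambda>n. measure ?P (A x n)) \<longlonglongrightarrow> measure ?P (I x)" for x
    unfolding I using sets dec by (intro finite_Lim_measure_decseq) auto
  have "decseq (\<lambda>n. A x n \<inter> A y n)"
    using dec[of x] dec[of y] unfolding decseq_def by blast
  then have "(\<lambda>n. measure ?P (A x n \<inter> A y n)) \<longlonglongrightarrow> measure ?P (\<Inter>n. A x n \<inter> A y n)"
    using sets by (intro finite_Lim_measure_decseq) auto
  moreover have "(\<Inter>n. A x n \<inter> A y n) = I x \<inter> I y" unfolding I by blast
  ultimately have lim2: "(\<lambda>n. measure ?P (A x n \<inter> A y n)) \<longlonglongrightarrow> measure ?P (I x \<inter> I y)"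
    by simp
  have "measure ?P (A x n) * measure ?P (A y n) \<le> measure ?P (A x n \<inter> A y n)" for n
    unfolding A_def by (intro harris_contains_some p V wit)
  then show "measure ?P (I x) * measure ?P (I y) \<le> measure ?P (I x \<inter> I y)"
    by (intro LIMSEQ_le[OF tendsto_mult[OF lim lim] lim2]) auto
qed

text \<open>Relabelling the sites by an automorphism preserves the product measure. The inequality in this
direction is the one that bounds the probability at \<open>v\<close> from below.\<close>

lemma percolation_prob_transitive_le:
  assumes "graph_transitive V E v0" "v0 \<in> V" "v \<in> V" "countable V"
  shows "percolation_prob V E v0 p \<le> percolation_prob V E v p"
proof -
  let ?P = "site_percolation V p"
  interpret prob_space ?P by (rule prob_space_site_percolation)
  obtain f where f: "graph_automorphism V E f" "f v0 = v"
    using assms unfolding graph_transitive_def by blast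
  have bij: "bij_betw f V V" using f by (simp add: graph_automorphism_def)
  define t where "t = (\<lambda>\<omega>. \<lambda>x\<in>V. \<omega> (f x) :: bool)"
  have t: "distr ?P ?P t = ?P"
    unfolding site_percolation_def t_def
    by (rule distr_PiM_reindex)
       (use bij in \<open>auto simp: bij_betw_def intro: measure_pmf.prob_space_axioms\<close>)
  have tm: "t \<in> measurable ?P ?P"
    unfolding site_percolation_def t_def
    by (intro measurable_restrict measurable_component_singleton) (use bij in \<open>auto simp: bij_betw_def\<close>)
  define I where "I x = {\<omega> \<in> space ?P. infinite (cluster E (occupied_sites V \<omega>) x)}" for x
  have sets: "I x \<in> sets ?P" for x
    unfolding I_def using assms by (intro sets_infinite_cluster)
  have "percolation_prob V E v0 p = measure (distr ?P ?P t) (I v0)"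
    unfolding percolation_prob_def t I_def ..
  also have "\<dots> = measure ?P (t -` I v0 \<inter> space ?P)"
    by (rule measure_distr[OF tm sets])
  also have "\<dots> \<le> measure ?P (I v)"
  proof (rule finite_measure_mono[OF _ sets], safe)
    fix \<omega> assume \<omega>: "\<omega> \<in> space ?P" "t \<omega> \<in> I v0"
    have eq: "occupied_sites V (t \<omega>) = {y \<in> V. f y \<in> occupied_sites V \<omega>}"
      using bij by (auto simp: occupied_sites_def t_def bij_betw_def)
    have "infinite (cluster E {y \<in> V. f y \<in> occupied_sites V \<omega>} v0)"
      using \<omega>(2) unfolding I_def mem_Collect_eq eq by simp
    then have "infinite (cluster E (occupied_sites V \<omega>) (f v0))"
      by (intro infinite_cluster_automorphism[OF f(1) _ \<open>v0 \<in> V\<close>]) (auto simp: occupied_sites_def)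
    then show "\<omega> \<in> I v" using \<omega> f by (simp add: I_def)
  qed
  finally show ?thesis by (simp add: percolation_prob_def I_def)
qed

section \<open>The probability of a connection through an occupied origin\<close>

text \<open>The starting site \<open>x\<close> is left out of the witnesses because it is occupied at each fire regardless
of the other sites: the relevant configurations live on \<open>V - {x}\<close>.\<close>

definition connection_witnesses :: "'v set \<Rightarrow> ('v \<Rightarrow> 'v \<Rightarrow> bool) \<Rightarrow> 'v \<Rightarrow> 'v \<Rightarrow> 'v set set" where
  "connection_witnesses V E x y = {F. finite F \<and> F \<subseteq> V - {x} \<and> y \<in> cluster E (insert x F) x}"

lemma cluster_insert_iff_connection_witness:
  assumes "A \<subseteq> V - {x}"
  shows "y \<in> cluster E (insert x A) x \<longleftrightarrow> (\<exists>F\<in>connection_witnesses V E x y. F \<subseteq> A)"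
proof
  assume "y \<in> cluster E (insert x A) x"
  then obtain F where F: "finite F" "y \<in> cluster E F x" "F \<subseteq> insert x A"
    unfolding mem_cluster_iff_finite_subset[of y E "insert x A" x] by auto
  have "y \<in> cluster E (insert x (F - {x})) x"
    using F(2) cluster_mono[of F "insert x (F - {x})" E x] by auto
  then show "\<exists>F\<in>connection_witnesses V E x y. F \<subseteq> A"
    using F assms by (intro bexI[of _ "F - {x}"]) (auto simp: connection_witnesses_def)
next
  assume "\<exists>F\<in>connection_witnesses V E x y. F \<subseteq> A"
  then obtain F where "F \<subseteq> A" "y \<in> cluster E (insert x F) x"
    by (auto simp: connection_witnesses_def)
  then show "y \<in> cluster E (insert x A) x"
    using cluster_mono[of "insert x F" "insert x A" E x] by auto
qed

text \<open>The event that \<open>v0\<close> and \<open>v\<close> are both in infinite clusters is, up to a null set, contained in the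
event that they are connected, since the infinite cluster is unique. A connection forces \<open>v0\<close>
to be occupied, and given this it depends on the other sites only; removing the independent
coordinate at \<open>v0\<close> therefore divides the probability by \<open>p\<close>.\<close>

lemma connection_prob_ge:
  assumes V: "countable V" "v0 \<in> V" "v \<in> V" and tr: "graph_transitive V E v0"
    and uniq: "at_most_one_infinite_cluster V E" and p: "0 < p" "p \<le> 1"
  shows "(percolation_prob V E v0 p)\<^sup>2 / p
    \<le> measure (site_percolation (V - {v0}) p) (contains_some (V - {v0}) p (connection_witnesses V E v0 v))"
proof -
  let ?P = "site_percolation V p" and ?P' = "site_percolation (V - {v0}) p"
  let ?B = "measure_pmf (bernoulli_pmf p)"
  let ?D' = "contains_some (V - {v0}) p (connection_witnesses V E v0 v)"
  interpret P: prob_space ?P by (rule prob_space_site_percolation)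
  interpret P': prob_space ?P' by (rule prob_space_site_percolation)
  define I where "I x = {\<omega> \<in> space ?P. infinite (cluster E (occupied_sites V \<omega>) x)}" for x
  define D where "D = {\<omega> \<in> space ?P. v \<in> cluster E (occupied_sites V \<omega>) v0}"
  have D'_sets: "?D' \<in> sets ?P'"
    using V by (intro sets_contains_some) (auto simp: connection_witnesses_def)
  have D_eq: "D = contains_some V p {F. finite F \<and> F \<subseteq> V \<and> v \<in> cluster E F v0}"
    unfolding D_def contains_some_def mem_cluster_iff_finite_subset[of v E "occupied_sites V _" v0]
    by (auto simp: occupied_sites_def)
  have D_sets: "D \<in> sets ?P"
    unfolding D_eq using V by (intro sets_contains_some) auto
  have I_sets: "I x \<in> sets ?P" for x
    unfolding I_def using V by (intro sets_infinite_cluster)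
  have "(percolation_prob V E v0 p)\<^sup>2 \<le> percolation_prob V E v0 p * percolation_prob V E v p"
    unfolding power2_eq_square using V tr
    by (intro mult_left_mono percolation_prob_transitive_le) (auto simp: percolation_prob_def)
  also have "\<dots> \<le> measure ?P (I v0 \<inter> I v)"
    unfolding percolation_prob_def I_def using p V by (intro harris_infinite_clusters) auto
  also have "\<dots> \<le> measure ?P D"
  proof (rule P.finite_measure_mono_AE[OF _ D_sets])
    have "AE \<omega> in ?P. \<exists>\<^sub>\<le>\<^sub>1 C. C \<in> clusters E (occupied_sites V \<omega>) \<and> infinite C"
      using uniq p unfolding at_most_one_infinite_cluster_def by auto
    then show "AE \<omega> in ?P. \<omega> \<in> I v0 \<inter> I v \<longrightarrow> \<omega> \<in> D"
    proof (eventually_elim, intro impI)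
      fix \<omega> assume u: "\<exists>\<^sub>\<le>\<^sub>1 C. C \<in> clusters E (occupied_sites V \<omega>) \<and> infinite C"
        and \<omega>: "\<omega> \<in> I v0 \<inter> I v"
      let ?A = "occupied_sites V \<omega>"
      have inf: "infinite (cluster E ?A v0)" "infinite (cluster E ?A v)" "\<omega> \<in> space ?P"
        using \<omega> by (auto simp: I_def)
      have occ: "x \<in> ?A" if "infinite (cluster E ?A x)" for x
      proof (rule ccontr)
        assume "x \<notin> ?A"
        then have "cluster E ?A x = {}" by (simp add: cluster_def)
        with that show False by simp
      qed
      have "cluster E ?A v0 = cluster E ?A v"
        using Uniq_D[OF u, of "cluster E ?A v0" "cluster E ?A v"] inf occ
        by (simp add: clusters_def)
      then show "\<omega> \<in> D"
        using cluster_self[OF occ[OF inf(2)], of E] inf(3) by (simp add: D_def)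
    qed
  qed
  also have "measure ?P D = p * measure ?P' ?D'"
  proof -
    let ?Q = "PiM (V - {v0}) (\<lambda>_. ?B)"
    have ins: "insert v0 (V - {v0}) = V" using V by auto
    have eq: "distr (?B \<Otimes>\<^sub>M ?Q) (PiM V (\<lambda>_. ?B)) (\<lambda>(b, \<omega>). fun_upd \<omega> v0 b) = PiM V (\<lambda>_. ?B)"
      using distr_pair_PiM_eq_PiM[of "V - {v0}" "\<lambda>_. ?B" v0]
      unfolding ins by (simp add: measure_pmf.prob_space_axioms)
    have meas: "(\<lambda>(b, \<omega>). fun_upd \<omega> v0 b) \<in> measurable (?B \<Otimes>\<^sub>M ?Q) (PiM V (\<lambda>_. ?B))"
      unfolding split_beta by (rule measurable_fun_upd[where J = "V - {v0}"]) (use V in auto)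
    have pre: "(\<lambda>(b, \<omega>). fun_upd \<omega> v0 b) -` D \<inter> space (?B \<Otimes>\<^sub>M ?Q) = {True} \<times> ?D'"
    proof (intro set_eqI)
      fix z :: "bool \<times> ('a \<Rightarrow> bool)"
      obtain b \<omega> where z: "z = (b, \<omega>)" by (cases z)
      let ?A' = "occupied_sites (V - {v0}) \<omega>"
      have occ: "occupied_sites V (fun_upd \<omega> v0 b) = (if b then insert v0 ?A' else ?A')"
        using V by (auto simp: occupied_sites_def)
      have *: "v \<in> cluster E (insert v0 ?A') v0 \<longleftrightarrow> (\<exists>F\<in>connection_witnesses V E v0 v. F \<subseteq> ?A')"
        by (rule cluster_insert_iff_connection_witness) (auto simp: occupied_sites_def)
      have **: "v \<notin> cluster E ?A' v0" by (auto simp: cluster_def occupied_sites_def)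
      have sp: "fun_upd \<omega> v0 b \<in> space ?P" if "\<omega> \<in> space ?P'"
        using that V by (auto simp: space_site_percolation PiE_iff extensional_def)
      have sp': "space ?Q = space ?P'" by (simp add: site_percolation_def)
      show "z \<in> (\<lambda>(b, \<omega>). fun_upd \<omega> v0 b) -` D \<inter> space (?B \<Otimes>\<^sub>M ?Q) \<longleftrightarrow> z \<in> {True} \<times> ?D'"
        unfolding z using * ** sp
        by (auto simp: D_def occ contains_some_def space_pair_measure sp' split: if_splits)
    qed
    interpret Q: prob_space ?Q by (intro prob_space_PiM measure_pmf.prob_space_axioms)
    have "emeasure ?P D = emeasure (distr (?B \<Otimes>\<^sub>M ?Q) (PiM V (\<lambda>_. ?B)) (\<lambda>(b, \<omega>). fun_upd \<omega> v0 b)) D"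
      unfolding eq by (simp add: site_percolation_def)
    also have "\<dots> = emeasure (?B \<Otimes>\<^sub>M ?Q) ({True} \<times> ?D')"
      using D_sets by (subst emeasure_distr[OF meas]) (simp_all add: pre site_percolation_def)
    also have "\<dots> = emeasure ?B {True} * emeasure ?Q ?D'"
      using D'_sets by (intro Q.emeasure_pair_measure_Times) (auto simp: site_percolation_def)
    also have "\<dots> = ennreal p * ennreal (measure ?P' ?D')"
      using p P'.emeasure_eq_measure[of ?D'] by (simp add: emeasure_pmf_single site_percolation_def)
    also have "\<dots> = ennreal (p * measure ?P' ?D')"
      using p by (simp add: ennreal_mult)
    finally show ?thesis
      using p by (simp add: P.emeasure_eq_measure)
  qed
  finally show ?thesis
    using p by (simp add: field_simps)
qed

lemma percolation_prob_le:
  assumes "countable V" "x \<in> V" "0 \<le> p" "p \<le> 1"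
  shows "percolation_prob V E x p \<le> p"
proof -
  let ?P = "site_percolation V p"
  interpret prob_space ?P by (rule prob_space_site_percolation)
  have C: "contains_some V p {{x}} = {\<omega> \<in> space ?P. True \<in> {True} \<and> {y \<in> {x}. \<omega> y} = {x}}"
    using assms by (auto simp: contains_some_def occupied_sites_def)
  have "percolation_prob V E x p \<le> measure ?P (contains_some V p {{x}})"
    unfolding percolation_prob_def
  proof (rule finite_measure_mono)
    show "contains_some V p {{x}} \<in> sets ?P" using assms by (intro sets_contains_some) auto
    show "{\<omega> \<in> space ?P. infinite (cluster E (occupied_sites V \<omega>) x)} \<subseteq> contains_some V p {{x}}"
    proof safe
      fix \<omega> assume *: "\<omega> \<in> space ?P" "infinite (cluster E (occupied_sites V \<omega>) x)"
      have "x \<in> occupied_sites V \<omega>"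
      proof (rule ccontr)
        assume "x \<notin> occupied_sites V \<omega>"
        then have "cluster E (occupied_sites V \<omega>) x = {}" by (simp add: cluster_def)
        with * show False by simp
      qed
      then show "\<omega> \<in> contains_some V p {{x}}" using * by (simp add: contains_some_def)
    qed
  qed
  also have "\<dots> = bernoulli_sum p {x} (\<lambda>A. of_bool (A = {x}))"
    unfolding C using assms percolation_finite_marginal[of p "{x}" V "\<lambda>A. A = {x}"] by simp
  also have "\<dots> = p"
    by (simp add: bernoulli_sum_def Pow_insert)
  finally show ?thesis .
qed

section \<open>Exponential gaps and the avoidance of intervals\<close>

definition std_exp :: "real measure" where
  "std_exp = density lborel (exponential_density 1)"

abbreviation exp_gaps :: "(nat \<Rightarrow> real) measure" where
  "exp_gaps \<equiv> PiM UNIV (\<lambda>_. std_exp)"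

lemma prob_space_std_exp: "prob_space std_exp"
  unfolding std_exp_def by (rule prob_space_exponential_density) simp

lemma sets_std_exp [measurable_cong, simp]: "sets std_exp = sets borel"
  by (simp add: std_exp_def)

lemma space_std_exp [simp]: "space std_exp = UNIV"
  by (simp add: std_exp_def)

lemma prob_space_exp_gaps: "prob_space exp_gaps"
  by (intro prob_space_PiM prob_space_std_exp)

lemma nn_integral_std_exp:
  assumes [measurable]: "f \<in> borel_measurable borel"
  shows "(\<integral>\<^sup>+u. f u \<partial>std_exp) = (\<integral>\<^sup>+u. ennreal (exponential_density 1 u) * f u \<partial>lborel)"
  unfolding std_exp_def by (subst nn_integral_density) auto

lemma AE_std_exp_pos: "AE u in std_exp. 0 < u"
proof -
  have "AE u in lborel. u \<noteq> (0::real)" by (rule AE_lborel_singleton)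
  then show ?thesis
    unfolding std_exp_def
    by (subst AE_density) (auto simp: exponential_density_def elim!: eventually_mono split: if_splits)
qed

lemma exponential_memoryless:
  assumes c: "0 \<le> c" and [measurable]: "f \<in> borel_measurable borel"
  shows "(\<integral>\<^sup>+u. indicator {c<..} u * f u \<partial>std_exp)
    = ennreal (exp (- c)) * (\<integral>\<^sup>+w. f (c + w) \<partial>std_exp)"
proof -
  have "(\<integral>\<^sup>+u. indicator {c<..} u * f u \<partial>std_exp)
      = (\<integral>\<^sup>+u. ennreal (exponential_density 1 u) * (indicator {c<..} u * f u) \<partial>lborel)"
    by (rule nn_integral_std_exp) measurable
  also have "\<dots> = (\<integral>\<^sup>+w. ennreal (exponential_density 1 (c + w)) * (indicator {c<..} (c + w) * f (c + w)) \<partial>lborel)"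
    using nn_integral_real_affine[where c = 1 and t = c and
        f = "\<lambda>u. ennreal (exponential_density 1 u) * (indicator {c<..} u * f u)"] by simp
  also have "\<dots> = (\<integral>\<^sup>+w. ennreal (exp (- c)) * (ennreal (exponential_density 1 w) * f (c + w)) \<partial>lborel)"
  proof (rule nn_integral_cong_AE)
    have "AE w in lborel. w \<noteq> (0::real)" by (rule AE_lborel_singleton)
    then show "AE w in lborel. ennreal (exponential_density 1 (c + w)) * (indicator {c<..} (c + w) * f (c + w))
        = ennreal (exp (- c)) * (ennreal (exponential_density 1 w) * f (c + w))"
    proof eventually_elim
      fix w :: real assume "w \<noteq> 0"
      then show "ennreal (exponential_density 1 (c + w)) * (indicator {c<..} (c + w) * f (c + w))
        = ennreal (exp (- c)) * (ennreal (exponential_density 1 w) * f (c + w))"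
        using c by (cases "0 < w")
          (auto simp: exponential_density_def ennreal_mult[symmetric] mult.assoc[symmetric] exp_add[symmetric])
    qed
  qed
  also have "\<dots> = ennreal (exp (- c)) * (\<integral>\<^sup>+w. f (c + w) \<partial>std_exp)"
    by (subst nn_integral_cmult) (simp_all add: nn_integral_std_exp)
  finally show ?thesis .
qed

text \<open>Splitting off the first gap leaves an independent sequence with the same law. All induction
arguments over arrivals below are first-step analyses based on this identity.\<close>

lemma nn_integral_exp_gaps_peel:
  assumes [measurable]: "f \<in> borel_measurable exp_gaps"
  shows "(\<integral>\<^sup>+\<omega>. f \<omega> \<partial>exp_gaps) = (\<integral>\<^sup>+u. \<integral>\<^sup>+\<omega>. f (case_nat u \<omega>) \<partial>exp_gaps \<partial>std_exp)"
proof -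
  interpret E: prob_space std_exp by (rule prob_space_std_exp)
  interpret S: prob_space exp_gaps by (rule prob_space_exp_gaps)
  interpret sequence_space std_exp by unfold_locales
  have "(\<integral>\<^sup>+\<omega>. f \<omega> \<partial>exp_gaps)
      = (\<integral>\<^sup>+\<omega>. f \<omega> \<partial>distr (std_exp \<Otimes>\<^sub>M exp_gaps) exp_gaps (\<lambda>(s, \<omega>). case_nat s \<omega>))"
    by (simp add: PiM_iter)
  also have "\<dots> = (\<integral>\<^sup>+z. f (case z of (s, \<omega>) \<Rightarrow> case_nat s \<omega>) \<partial>(std_exp \<Otimes>\<^sub>M exp_gaps))"
    by (rule nn_integral_distr) measurable
  also have "\<dots> = (\<integral>\<^sup>+u. \<integral>\<^sup>+\<omega>. f (case_nat u \<omega>) \<partial>exp_gaps \<partial>std_exp)"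
  proof (subst S.nn_integral_fst[symmetric])
    have "(\<lambda>(s, \<omega>). case_nat s \<omega>) \<in> measurable (std_exp \<Otimes>\<^sub>M exp_gaps) exp_gaps"
      by measurable
    then show "(\<lambda>z. f (case z of (s, \<omega>) \<Rightarrow> case_nat s \<omega>)) \<in> borel_measurable (std_exp \<Otimes>\<^sub>M exp_gaps)"
      by (rule measurable_compose) measurable
  qed simp
  finally show ?thesis .
qed

lemma sum_case_nat: "(\<Sum>k<Suc n. case_nat u \<omega> k) = u + (\<Sum>k<n. \<omega> k :: real)"
  by (subst sum.lessThan_Suc_shift) simp

lemma nn_integral_std_exp_exp_minus: "(\<integral>\<^sup>+u. ennreal (exp (- u)) \<partial>std_exp) = ennreal (1 / 2)"
proof -
  have "(\<integral>\<^sup>+u. ennreal (exp (- u)) \<partial>std_exp)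
      = (\<integral>\<^sup>+u. ennreal (exponential_density 1 u) * ennreal (exp (- u)) \<partial>lborel)"
    by (rule nn_integral_std_exp) measurable
  also have "\<dots> = (\<integral>\<^sup>+u. ennreal (1 / 2) * ennreal (exponential_density 2 u) \<partial>lborel)"
  proof (intro nn_integral_cong)
    fix u :: real
    have "exponential_density 1 u * exp (- u) = 1 / 2 * exponential_density 2 u"
      by (simp add: exponential_density_def exp_add[symmetric])
    then show "ennreal (exponential_density 1 u) * ennreal (exp (- u))
        = ennreal (1 / 2) * ennreal (exponential_density 2 u)"
      using ennreal_mult[of "exponential_density 1 u" "exp (- u)"]
        ennreal_mult[of "1 / 2" "exponential_density 2 u"]
      by (simp only: exponential_density_nonneg exp_ge_zero)
  qed
  also have "\<dots> = ennreal (1 / 2) * (\<integral>\<^sup>+u. ennreal (exponential_density 2 u) \<partial>lborel)"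
    by (rule nn_integral_cmult) measurable
  also have "(\<integral>\<^sup>+u. ennreal (exponential_density 2 u) \<partial>lborel) = 1"
  proof -
    interpret prob_space "density lborel (exponential_density 2)"
      by (rule prob_space_exponential_density) simp
    show ?thesis using emeasure_space_1 by (simp add: emeasure_density)
  qed
  finally show ?thesis by simp
qed

lemma nn_integral_exp_minus_arrival:
  "(\<integral>\<^sup>+\<omega>. ennreal (exp (- (\<Sum>k<n. \<omega> k))) \<partial>exp_gaps) = ennreal ((1 / 2) ^ n)"
proof (induction n)
  case 0
  interpret prob_space exp_gaps by (rule prob_space_exp_gaps)
  show ?case by (simp add: emeasure_space_1)
next
  case (Suc n)
  have "(\<integral>\<^sup>+\<omega>. ennreal (exp (- (\<Sum>k<Suc n. \<omega> k))) \<partial>exp_gaps)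
      = (\<integral>\<^sup>+u. \<integral>\<^sup>+\<omega>. ennreal (exp (- u)) * ennreal (exp (- (\<Sum>k<n. \<omega> k))) \<partial>exp_gaps \<partial>std_exp)"
    by (subst nn_integral_exp_gaps_peel)
       (measurable, simp only: sum_case_nat minus_add_distrib exp_add ennreal_mult exp_ge_zero)
  also have "\<dots> = (\<integral>\<^sup>+u. ennreal (exp (- u)) * ennreal ((1 / 2) ^ n) \<partial>std_exp)"
    by (subst nn_integral_cmult) (measurable, simp add: Suc.IH)
  also have "\<dots> = ennreal (1 / 2) * ennreal ((1 / 2) ^ n)"
    by (subst nn_integral_multc) (measurable, simp only: nn_integral_std_exp_exp_minus)
  also have "\<dots> = ennreal ((1 / 2) ^ Suc n)"
    unfolding power_Suc by (rule ennreal_mult[symmetric]) auto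
  finally show ?case .
qed

text \<open>By Markov's inequality for \<open>e\<^bsup>-S\<^esup>\<close>, the probability that the \<open>n\<close>-th arrival comes before \<open>R\<close> is
at most \<open>e\<^sup>R 2\<^bsup>-n\<^esup>\<close>.\<close>

lemma AE_arrivals_unbounded: "AE \<omega> in exp_gaps. \<exists>n. R \<le> (\<Sum>k<n. \<omega> k)"
proof -
  interpret prob_space exp_gaps by (rule prob_space_exp_gaps)
  let ?N = "{\<omega> \<in> space exp_gaps. \<forall>n. (\<Sum>k<n. \<omega> k) < R}"
  have [measurable]: "?N \<in> sets exp_gaps" by measurable
  have "emeasure exp_gaps ?N \<le> ennreal (exp R * (1 / 2) ^ n)" for n
  proof -
    have "emeasure exp_gaps ?N = (\<integral>\<^sup>+\<omega>. indicator ?N \<omega> \<partial>exp_gaps)" by simp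
    also have "\<dots> \<le> (\<integral>\<^sup>+\<omega>. ennreal (exp R) * ennreal (exp (- (\<Sum>k<n. \<omega> k))) \<partial>exp_gaps)"
    proof (intro nn_integral_mono)
      fix \<omega> assume "\<omega> \<in> space exp_gaps"
      show "indicator ?N \<omega> \<le> ennreal (exp R) * ennreal (exp (- (\<Sum>k<n. \<omega> k)))"
      proof (cases "\<omega> \<in> ?N")
        case True
        then have "(\<Sum>k<n. \<omega> k) < R" by blast
        then have "1 \<le> exp (R + - (\<Sum>k<n. \<omega> k))" by simp
        then show ?thesis using True by (simp add: ennreal_mult[symmetric] exp_add[symmetric])
      qed simp
    qed
    also have "\<dots> = ennreal (exp R * (1 / 2) ^ n)"
      by (subst nn_integral_cmult) (measurable, simp add: nn_integral_exp_minus_arrival ennreal_mult)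
    finally show ?thesis .
  qed
  moreover have "(\<lambda>n. ennreal (exp R * (1 / 2) ^ n)) \<longlonglongrightarrow> ennreal (exp R * 0)"
    by (intro tendsto_ennrealI tendsto_mult tendsto_const LIMSEQ_realpow_zero) auto
  ultimately have "emeasure exp_gaps ?N \<le> ennreal (exp R * 0)"
    by (intro LIMSEQ_le_const) auto
  then have "emeasure exp_gaps ?N = 0" by simp
  then have "AE \<omega> in exp_gaps. \<omega> \<notin> ?N"
    by (intro AE_not_in) (simp add: null_sets_def)
  then show ?thesis
    using AE_space by eventually_elim (auto simp: not_less)
qed

lemma AE_exp_gaps_pos: "AE \<omega> in exp_gaps. \<forall>k. 0 < \<omega> k"
  unfolding AE_all_countable
  by (intro allI AE_PiM_component prob_space_std_exp AE_std_exp_pos) auto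

text \<open>The first-step equation for \<open>g t\<close>, the probability that a Poisson process started at time \<open>t\<close>
never has an arrival in \<open>U\<close>: the first arrival \<open>t + u\<close> must lie outside \<open>U\<close>, and then the
process restarts there.\<close>

definition avoidance_harmonic :: "real set \<Rightarrow> (real \<Rightarrow> ennreal) \<Rightarrow> bool" where
  "avoidance_harmonic U g \<longleftrightarrow>
     (\<forall>t\<ge>0. (\<integral>\<^sup>+u. (if t + u \<in> U then 0 else g (t + u)) \<partial>std_exp) = g t)"

lemma avoidance_harmonic_iterate:
  assumes [measurable]: "U \<in> sets borel" "g \<in> borel_measurable borel"
    and g: "avoidance_harmonic U g" and t: "0 \<le> t"
  shows "(\<integral>\<^sup>+\<omega>. (if \<exists>k\<in>{1..n}. t + (\<Sum>i<k. \<omega> i) \<in> U then 0 else g (t + (\<Sum>i<n. \<omega> i))) \<partial>exp_gaps) = g t"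
  using t
proof (induction n arbitrary: t)
  case 0
  interpret prob_space exp_gaps by (rule prob_space_exp_gaps)
  show ?case by (simp add: emeasure_space_1)
next
  case (Suc n)
  have Ex: "(\<exists>k\<in>{1..Suc n}. P k) \<longleftrightarrow> P (Suc 0) \<or> (\<exists>k\<in>{1..n}. P (Suc k))" for P
  proof -
    have "{1..Suc n} = insert (Suc 0) (Suc ` {1..n})"
      by (auto simp: image_Suc_atLeastAtMost)
    then show ?thesis unfolding Bex_def by (simp only: insert_iff image_iff) blast
  qed
  let ?h = "\<lambda>n t \<omega>. if \<exists>k\<in>{1..n}. t + (\<Sum>i<k. \<omega> i) \<in> U then 0 else g (t + (\<Sum>i<n. \<omega> i))"
  have h: "?h (Suc n) t (case_nat u \<omega>) = (if t + u \<in> U then 0 else ?h n (t + u) \<omega>)" for u \<omega>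
    unfolding Ex sum_case_nat by (simp add: add.assoc)
  have "(\<integral>\<^sup>+\<omega>. ?h (Suc n) t \<omega> \<partial>exp_gaps)
      = (\<integral>\<^sup>+u. \<integral>\<^sup>+\<omega>. ?h (Suc n) t (case_nat u \<omega>) \<partial>exp_gaps \<partial>std_exp)"
    by (rule nn_integral_exp_gaps_peel) measurable
  also have "\<dots> = (\<integral>\<^sup>+u. (if t + u \<in> U then 0 else g (t + u)) \<partial>std_exp)"
  proof (rule nn_integral_cong_AE)
    show "AE u in std_exp. (\<integral>\<^sup>+\<omega>. ?h (Suc n) t (case_nat u \<omega>) \<partial>exp_gaps)
        = (if t + u \<in> U then 0 else g (t + u))"
      using AE_std_exp_pos
    proof eventually_elim
      fix u :: real assume "0 < u"
      then have "(\<integral>\<^sup>+\<omega>. ?h n (t + u) \<omega> \<partial>exp_gaps) = g (t + u)"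
        using Suc.prems by (intro Suc.IH) simp
      then show "(\<integral>\<^sup>+\<omega>. ?h (Suc n) t (case_nat u \<omega>) \<partial>exp_gaps) = (if t + u \<in> U then 0 else g (t + u))"
        unfolding h by simp
    qed
  qed
  also have "\<dots> = g t" using g Suc.prems by (simp add: avoidance_harmonic_def)
  finally show ?case .
qed

text \<open>Iterating the equation \<open>n\<close> times writes \<open>g 0\<close> as the expectation of \<open>g\<close> at the \<open>n\<close>-th arrival on
the event that the first \<open>n\<close> arrivals avoid \<open>U\<close>. Once the \<open>n\<close>-th arrival has passed \<open>R\<close>, the quantity
inside the expectation is the indicator of avoiding \<open>U\<close>, so dominated convergence gives the claim.\<close>

lemma avoidance_probability:
  assumes [measurable]: "U \<in> sets borel" "g \<in> borel_measurable borel"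
    and g: "avoidance_harmonic U g" and le1: "\<And>t. g t \<le> 1" and R: "\<And>t. R \<le> t \<Longrightarrow> g t = 1"
    and U: "U \<subseteq> {..R}"
  shows "emeasure exp_gaps {\<omega> \<in> space exp_gaps. \<forall>k\<ge>1. (\<Sum>i<k. \<omega> i) \<notin> U} = g 0"
proof -
  interpret prob_space exp_gaps by (rule prob_space_exp_gaps)
  let ?B = "{\<omega> \<in> space exp_gaps. \<forall>k\<ge>1. (\<Sum>i<k. \<omega> i) \<notin> U}"
  let ?h = "\<lambda>n \<omega>. if \<exists>k\<in>{1..n}. 0 + (\<Sum>i<k. \<omega> i) \<in> U then 0 else g (0 + (\<Sum>i<n. \<omega> i))"
  have "AE \<omega> in exp_gaps. (\<lambda>n. ?h n \<omega>) \<longlonglongrightarrow> indicator ?B \<omega>"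
    using AE_exp_gaps_pos AE_arrivals_unbounded[of "R + 1"] AE_space
  proof eventually_elim
    fix \<omega> :: "nat \<Rightarrow> real"
    assume pos: "\<forall>k. 0 < \<omega> k" and "\<exists>n. R + 1 \<le> (\<Sum>k<n. \<omega> k)" and sp: "\<omega> \<in> space exp_gaps"
    then obtain N where N: "R + 1 \<le> (\<Sum>k<N. \<omega> k)" by blast
    have past: "R < (\<Sum>k<n. \<omega> k)" if "N \<le> n" for n
    proof -
      have "(\<Sum>k<N. \<omega> k) \<le> (\<Sum>k<n. \<omega> k)"
        using that pos by (intro sum_mono2) (auto intro: less_imp_le)
      with N show ?thesis by simp
    qed
    have "?h n \<omega> = indicator ?B \<omega>" if "N \<le> n" for n
    proof -
      have "k \<le> n" if "(\<Sum>i<k. \<omega> i) \<in> U" for k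
        using past[of k] that U \<open>N \<le> n\<close> by (meson atMost_iff linorder_not_less nle_le subsetD order_trans)
      then have "(\<exists>k\<in>{1..n}. (\<Sum>i<k. \<omega> i) \<in> U) \<longleftrightarrow> \<omega> \<notin> ?B"
        using sp by auto
      then show ?thesis
        using R[of "\<Sum>k<n. \<omega> k"] past[OF that] by (auto simp: indicator_def)
    qed
    then show "(\<lambda>n. ?h n \<omega>) \<longlonglongrightarrow> indicator ?B \<omega>"
      by (intro tendsto_eventually eventually_sequentiallyI)
  qed
  then have "(\<lambda>n. \<integral>\<^sup>+\<omega>. ?h n \<omega> \<partial>exp_gaps) \<longlonglongrightarrow> (\<integral>\<^sup>+\<omega>. indicator ?B \<omega> \<partial>exp_gaps)"
  proof (rule nn_integral_dominated_convergence[where w = "\<lambda>_. 1", rotated -1])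
    show "AE \<omega> in exp_gaps. ?h n \<omega> \<le> 1" for n
      by (intro AE_I2) (simp add: le1)
  qed (measurable, simp add: emeasure_space_1)
  moreover have "(\<integral>\<^sup>+\<omega>. ?h n \<omega> \<partial>exp_gaps) = g 0" for n
    by (rule avoidance_harmonic_iterate) (use g in auto)
  ultimately have "(\<integral>\<^sup>+\<omega>. indicator ?B \<omega> \<partial>exp_gaps) = g 0"
    by (simp add: LIMSEQ_const_iff)
  then show ?thesis by simp
qed

text \<open>A solution extends to the left across a new interval: inside \<open>(a, a + d]\<close> the process must
wait without arrival until \<open>a + d\<close>, and to the left of \<open>a\<close> nothing is forbidden before time \<open>a\<close>,
so that the solution is constant there. Both cases are the memoryless property.\<close>

lemma avoidance_harmonic_add_interval:
  assumes [measurable]: "U \<in> sets borel" "g \<in> borel_measurable borel"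
    and g: "avoidance_harmonic U g" and a: "0 \<le> a" "0 \<le> d" and U: "U \<subseteq> {a + d<..}"
  shows "avoidance_harmonic ({a<..a + d} \<union> U)
    (\<lambda>t. if a + d \<le> t then g t else ennreal (exp (- (a + d - max a t))) * g (a + d))"
    (is "avoidance_harmonic ?U ?g")
  unfolding avoidance_harmonic_def
proof (intro allI impI)
  fix t :: real assume t: "0 \<le> t"
  let ?f = "\<lambda>t u. if t + u \<in> ?U then 0 else ?g (t + u)"
  let ?h = "\<lambda>t u. if t + u \<in> U then 0 else g (t + u)"
  have g0: "(\<integral>\<^sup>+u. ?h t u \<partial>std_exp) = g t" if "0 \<le> t" for t
    using g that by (simp add: avoidance_harmonic_def)
  have inside: "(\<integral>\<^sup>+u. ?f t u \<partial>std_exp) = ?g t" if t: "a \<le> t" "t < a + d" for t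
  proof -
    let ?c = "a + d - t"
    have "(\<integral>\<^sup>+u. ?f t u \<partial>std_exp) = (\<integral>\<^sup>+u. indicator {?c<..} u * ?h t u \<partial>std_exp)"
    proof (rule nn_integral_cong_AE, use AE_std_exp_pos in eventually_elim)
      fix u :: real assume u: "0 < u"
      show "?f t u = indicator {?c<..} u * ?h t u"
      proof (cases "?c < u")
        case True
        then have "a + d \<le> t + u" "t + u \<notin> {a<..a + d}" by auto
        then show ?thesis using True by simp
      next
        case False
        then have "t + u \<in> {a<..a + d} \<union> U" using t u by auto
        then have "?f t u = 0" by (rule if_P)
        then show ?thesis using False by simp
      qed
    qed
    also have "\<dots> = ennreal (exp (- ?c)) * (\<integral>\<^sup>+w. ?h t (?c + w) \<partial>std_exp)"
      using t by (intro exponential_memoryless) auto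
    also have "(\<integral>\<^sup>+w. ?h t (?c + w) \<partial>std_exp) = g (a + d)"
    proof -
      have "t + (?c + w) = a + d + w" for w by simp
      then show ?thesis using g0[of "a + d"] a by (simp only: add_nonneg_nonneg)
    qed
    finally show ?thesis using t by simp
  qed
  consider "a + d \<le> t" | "a \<le> t" "t < a + d" | "t < a" "t < a + d" using a by linarith
  then show "(\<integral>\<^sup>+u. ?f t u \<partial>std_exp) = ?g t"
  proof cases
    case 1
    have "(\<integral>\<^sup>+u. ?f t u \<partial>std_exp) = (\<integral>\<^sup>+u. ?h t u \<partial>std_exp)"
      by (rule nn_integral_cong_AE, use AE_std_exp_pos in eventually_elim) (use 1 in auto)
    then show ?thesis using 1 g0 t by simp
  next
    case 2
    then show ?thesis by (rule inside)
  next
    case 3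
    let ?c = "a - t" and ?K = "?g t"
    have K: "?g s = ?K" if "s \<le> a" for s
      using that 3 a by (cases "d = 0") auto
    have fa: "(\<integral>\<^sup>+u. ?f a u \<partial>std_exp) = ?g a"
    proof (cases "d = 0")
      case True
      have "(\<integral>\<^sup>+u. ?f a u \<partial>std_exp) = (\<integral>\<^sup>+u. ?h a u \<partial>std_exp)"
        by (rule nn_integral_cong_AE, use AE_std_exp_pos in eventually_elim) (use True in auto)
      then show ?thesis using True g0 a by simp
    next
      case False
      then show ?thesis using a by (intro inside) auto
    qed
    have split: "(\<integral>\<^sup>+u. f u \<partial>std_exp)
        = (\<integral>\<^sup>+u. indicator {..?c} u * f u \<partial>std_exp) + (\<integral>\<^sup>+u. indicator {?c<..} u * f u \<partial>std_exp)"
      if [measurable]: "f \<in> borel_measurable borel" for f :: "real \<Rightarrow> ennreal"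
      by (subst nn_integral_add[symmetric]) (auto intro!: nn_integral_cong simp: indicator_def)
    have "(\<integral>\<^sup>+u. ?f t u \<partial>std_exp)
        = (\<integral>\<^sup>+u. indicator {..?c} u * ?f t u \<partial>std_exp) + (\<integral>\<^sup>+u. indicator {?c<..} u * ?f t u \<partial>std_exp)"
      by (rule split) measurable
    also have "(\<integral>\<^sup>+u. indicator {..?c} u * ?f t u \<partial>std_exp) = (\<integral>\<^sup>+u. indicator {..?c} u * ?K \<partial>std_exp)"
    proof (intro nn_integral_cong)
      fix u :: real
      show "indicator {..?c} u * ?f t u = indicator {..?c} u * ?K"
      proof (cases "u \<le> ?c")
        case True
        then have "t + u \<notin> ?U" using U a by auto
        then have "?f t u = ?g (t + u)" by (rule if_not_P)
        also have "\<dots> = ?K" using True by (intro K) simp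
        finally show ?thesis by (rule arg_cong)
      qed simp
    qed
    also have "(\<integral>\<^sup>+u. indicator {?c<..} u * ?f t u \<partial>std_exp)
        = ennreal (exp (- ?c)) * (\<integral>\<^sup>+w. ?f t (?c + w) \<partial>std_exp)"
      using 3 by (intro exponential_memoryless) auto
    also have "(\<integral>\<^sup>+w. ?f t (?c + w) \<partial>std_exp) = ?K"
    proof -
      have "t + (?c + w) = a + w" for w by simp
      then have "(\<integral>\<^sup>+w. ?f t (?c + w) \<partial>std_exp) = ?g a"
        using fa by (simp only:)
      also have "\<dots> = ?K" by (rule K) simp
      finally show ?thesis .
    qed
    also have "ennreal (exp (- ?c)) * ?K = (\<integral>\<^sup>+u. indicator {?c<..} u * ?K \<partial>std_exp)"
    proof -
      interpret prob_space std_exp by (rule prob_space_std_exp)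
      show ?thesis
        using 3 by (subst exponential_memoryless) (auto simp: emeasure_space_1[simplified])
    qed
    also have "(\<integral>\<^sup>+u. indicator {..?c} u * ?K \<partial>std_exp) + (\<integral>\<^sup>+u. indicator {?c<..} u * ?K \<partial>std_exp)
        = (\<integral>\<^sup>+u. ?K \<partial>std_exp)"
      by (rule split[symmetric]) measurable
    also have "\<dots> = ?K"
    proof -
      interpret prob_space std_exp by (rule prob_space_std_exp)
      show ?thesis by (simp add: emeasure_space_1[simplified])
    qed
    finally show ?thesis .
  qed
qed

text \<open>Intervals are indexed by their left end points and are added from right to left; each
multiplies the value on the left by \<open>e\<^bsup>-d\<^esup>\<close>.\<close>

lemma avoidance_harmonic_intervals:
  assumes "finite A" and d: "0 \<le> d" and "\<And>a. a \<in> A \<Longrightarrow> 0 \<le> a"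
    and "\<And>a b. a \<in> A \<Longrightarrow> b \<in> A \<Longrightarrow> a < b \<Longrightarrow> a + d \<le> b"
  shows "\<exists>g R. g \<in> borel_measurable borel \<and> avoidance_harmonic (\<Union>a\<in>A. {a<..a + d}) g \<and>
    (\<forall>t. g t \<le> 1) \<and> (\<forall>t\<ge>R. g t = 1) \<and> (\<Union>a\<in>A. {a<..a + d}) \<subseteq> {..R} \<and>
    (\<forall>t\<ge>0. (\<forall>a\<in>A. t \<le> a) \<longrightarrow> g t = ennreal (exp (- d * card A)))"
  using assms(1,3,4)
proof (induction A rule: finite_linorder_min_induct)
  case empty
  interpret prob_space std_exp by (rule prob_space_std_exp)
  show ?case
    by (intro exI[of _ "\<lambda>_. 1"] exI[of _ 0])
       (auto simp: avoidance_harmonic_def emeasure_space_1[simplified])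
next
  case (insert b A)
  let ?U = "\<Union>a\<in>A. {a<..a + d}"
  have A: "0 \<le> a" if "a \<in> A" for a
    using insert.prems(1) that by simp
  have A': "a + d \<le> a'" if "a \<in> A" "a' \<in> A" "a < a'" for a a'
    using insert.prems(2)[of a a'] that by simp
  let ?P = "\<lambda>g R. g \<in> borel_measurable borel \<and> avoidance_harmonic ?U g \<and>
    (\<forall>t. g t \<le> 1) \<and> (\<forall>t\<ge>R. g t = 1) \<and> ?U \<subseteq> {..R} \<and>
    (\<forall>t\<ge>0. (\<forall>a\<in>A. t \<le> a) \<longrightarrow> g t = ennreal (exp (- d * card A)))"
  have "\<exists>g R. ?P g R"
    by (rule insert.IH) (fact A, fact A')
  then obtain g R where gR: "?P g R" by (elim exE)
  have [measurable]: "g \<in> borel_measurable borel" using gR by (rule conjunct1)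
  have g: "avoidance_harmonic ?U g" "\<And>t. g t \<le> 1" "\<And>t. R \<le> t \<Longrightarrow> g t = 1" "?U \<subseteq> {..R}"
      "\<And>t. 0 \<le> t \<Longrightarrow> \<forall>a\<in>A. t \<le> a \<Longrightarrow> g t = ennreal (exp (- d * card A))"
    using gR by simp_all
  let ?g = "\<lambda>t. if b + d \<le> t then g t else ennreal (exp (- (b + d - max b t))) * g (b + d)"
  have b: "0 \<le> b" using insert.prems by simp
  have sep: "b + d \<le> a" if "a \<in> A" for a
    using insert.prems(2)[of b a] insert.hyps that by auto
  have [measurable]: "?U \<in> sets borel"
    using insert.hyps by (intro sets.finite_UN) auto
  have harm: "avoidance_harmonic ({b<..b + d} \<union> ?U) ?g"
  proof (rule avoidance_harmonic_add_interval[OF _ _ g(1) b d])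
    show "?U \<subseteq> {b + d<..}"
    proof
      fix u assume "u \<in> ?U"
      then obtain a where "a \<in> A" "a < u" by auto
      then show "u \<in> {b + d<..}" using sep[of a] by simp
    qed
  qed measurable
  have gb: "g (b + d) = ennreal (exp (- d * card A))"
    using sep b d by (intro g(5)) auto
  show ?case
  proof (intro exI[of _ ?g] exI[of _ "max R (b + d)"] conjI allI impI)
    show "?g \<in> borel_measurable borel" by measurable
    show "avoidance_harmonic (\<Union>a\<in>insert b A. {a<..a + d}) ?g"
      using harm by simp
    show "?g t \<le> 1" for t
    proof -
      have "ennreal (exp (- (b + d - max b t))) * g (b + d) \<le> 1 * 1" if "\<not> b + d \<le> t"
        using that d by (intro mult_mono g(2)) auto
      then show ?thesis using g(2)[of t] by auto
    qed
    show "?g t = 1" if "max R (b + d) \<le> t" for t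
      using that g(3) by simp
    show "(\<Union>a\<in>insert b A. {a<..a + d}) \<subseteq> {..max R (b + d)}"
      using g(4) by (auto simp: le_max_iff_disj)
    show "?g t = ennreal (exp (- d * card (insert b A)))"
      if t: "0 \<le> t" "\<forall>a\<in>insert b A. t \<le> a" for t
    proof (cases "d = 0 \<and> t = b")
      case True
      then show ?thesis using gb by simp
    next
      case False
      then have "\<not> b + d \<le> t" "max b t = b" using t d by auto
      moreover have "card (insert b A) = Suc (card A)"
        using insert.hyps by auto
      ultimately show ?thesis
        using gb by (simp add: ennreal_mult[symmetric] exp_add[symmetric] algebra_simps)
    qed
  qed
qed

lemma avoid_intervals_probability:
  assumes "finite A" and "0 \<le> d" and "\<And>a. a \<in> A \<Longrightarrow> 0 \<le> a"
    and "\<And>a b. a \<in> A \<Longrightarrow> b \<in> A \<Longrightarrow> a < b \<Longrightarrow> a + d \<le> b"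
  shows "emeasure exp_gaps {\<omega> \<in> space exp_gaps. \<forall>k\<ge>1. (\<Sum>i<k. \<omega> i) \<notin> (\<Union>a\<in>A. {a<..a + d})}
    = ennreal (exp (- d * card A))"
proof -
  let ?P = "\<lambda>g R. g \<in> borel_measurable borel \<and> avoidance_harmonic (\<Union>a\<in>A. {a<..a + d}) g \<and>
    (\<forall>t. g t \<le> 1) \<and> (\<forall>t\<ge>R. g t = 1) \<and> (\<Union>a\<in>A. {a<..a + d}) \<subseteq> {..R} \<and>
    (\<forall>t\<ge>0. (\<forall>a\<in>A. t \<le> a) \<longrightarrow> g t = ennreal (exp (- d * card A)))"
  have "\<exists>g R. ?P g R"
    by (rule avoidance_harmonic_intervals) fact+
  then obtain g R where gR: "?P g R" by (elim exE)
  have g: "g \<in> borel_measurable borel" "avoidance_harmonic (\<Union>a\<in>A. {a<..a + d}) g"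
      "\<And>t. g t \<le> 1" "\<And>t. R \<le> t \<Longrightarrow> g t = 1" "(\<Union>a\<in>A. {a<..a + d}) \<subseteq> {..R}"
      "\<And>t. 0 \<le> t \<Longrightarrow> \<forall>a\<in>A. t \<le> a \<Longrightarrow> g t = ennreal (exp (- d * card A))"
    using gR by simp_all
  have "(\<Union>a\<in>A. {a<..a + d}) \<in> sets borel"
    using assms(1) by (intro sets.finite_UN) auto
    then show ?thesis
    using avoidance_probability[OF _ g(1-5)] g(6)[of 0] assms(3) by simp
qed

section \<open>Sites hit in disjoint time windows\<close>

lemma (in prob_space) indep_vars_bool:
  assumes meas: "\<And>i. i \<in> I \<Longrightarrow> Measurable.pred M (P i)"
    and indep: "indep_events (\<lambda>i. {\<omega> \<in> space M. \<not> P i \<omega>}) I"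
  shows "indep_vars (\<lambda>_. count_space UNIV) P I"
  unfolding indep_vars_def2
proof (intro conjI ballI)
  let ?A = "\<lambda>i. {\<omega> \<in> space M. \<not> P i \<omega>}"
  have "indep_sets (\<lambda>i. sigma_sets (space M) {?A i}) I"
    using indep unfolding indep_events_def_alt by (rule indep_sets_sigma) (simp add: Int_stable_def)
  then show "indep_sets (\<lambda>i. {P i -` B \<inter> space M |B. B \<in> sets (count_space UNIV)}) I"
  proof (rule indep_sets_mono_sets)
    fix i
    show "{P i -` B \<inter> space M |B. B \<in> sets (count_space UNIV)} \<subseteq> sigma_sets (space M) {?A i}"
    proof safe
      fix B :: "bool set"
      have A: "?A i \<in> sigma_sets (space M) {?A i}" by (rule sigma_sets.Basic) simp
      have "(if False \<in> B then ?A i else {}) \<union> (if True \<in> B then space M - ?A i else {})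
          \<in> sigma_sets (space M) {?A i}"
        using A by (intro sigma_sets_Un) (auto intro: sigma_sets.Empty sigma_sets.Compl)
      also have "(if False \<in> B then ?A i else {}) \<union> (if True \<in> B then space M - ?A i else {})
          = P i -` B \<inter> space M"
      proof (rule set_eqI)
        fix \<omega>
        show "\<omega> \<in> (if False \<in> B then ?A i else {}) \<union> (if True \<in> B then space M - ?A i else {})
            \<longleftrightarrow> \<omega> \<in> P i -` B \<inter> space M"
          by (cases "P i \<omega>") auto
      qed
      finally show "P i -` B \<inter> space M \<in> sigma_sets (space M) {?A i}" .
    qed
  qed
qed (rule meas)

lemma poisson_gap_distr:
  assumes "poisson_arrivals M V X" "x \<in> V"
  shows "distr M borel (X x n) = std_exp" and "X x n \<in> borel_measurable M"
proof -
  have D: "distributed M lborel (X x n) (exponential_density 1)"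
    using assms by (auto simp: poisson_arrivals_def)
  then show [measurable]: "X x n \<in> borel_measurable M" by (auto simp: distributed_def)
  have "distr M borel (X x n) = distr M lborel (X x n)"
    by (rule distr_cong) auto
  also have "\<dots> = std_exp"
    using D by (simp add: distributed_def std_exp_def)
  finally show "distr M borel (X x n) = std_exp" .
qed

lemma poisson_sequence_distr:
  assumes P: "poisson_arrivals M V X" and x: "x \<in> V"
  shows "distr M exp_gaps (\<lambda>\<omega> n. X x n \<omega>) = exp_gaps"
proof -
  interpret prob_space M using P by (simp add: poisson_arrivals_def)
  let ?K = "{x} \<times> (UNIV :: nat set)"
  let ?X = "\<lambda>(x, n). X x n"
  have [measurable]: "X x n \<in> borel_measurable M" for n
    using P x by (rule poisson_gap_distr)
  have rv: "random_variable borel (?X i)" if "i \<in> ?K" for i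
    using that by auto
  have "indep_vars (\<lambda>_. borel) ?X (V \<times> UNIV)"
    using P by (simp add: poisson_arrivals_def)
  then have "indep_vars (\<lambda>_. borel) ?X ?K"
    by (rule indep_vars_subset) (use x in auto)
  then have eq: "distr M (PiM ?K (\<lambda>_. borel)) (\<lambda>\<omega>. \<lambda>i\<in>?K. ?X i \<omega>) = PiM ?K (\<lambda>i. distr M borel (?X i))"
    using rv by (subst (asm) indep_vars_iff_distr_eq_PiM') auto
  also have "\<dots> = PiM ?K (\<lambda>_. std_exp)"
    using poisson_gap_distr(1)[OF P x] by (intro PiM_cong) auto
  finally have eq: "distr M (PiM ?K (\<lambda>_. borel)) (\<lambda>\<omega>. \<lambda>i\<in>?K. ?X i \<omega>) = PiM ?K (\<lambda>_. std_exp)" .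
  have "exp_gaps = distr (PiM ?K (\<lambda>_. std_exp)) exp_gaps (\<lambda>z. \<lambda>n\<in>UNIV. z (x, n))"
    by (rule distr_PiM_reindex[symmetric]) (auto simp: inj_on_def prob_space_std_exp)
  also have "\<dots> = distr (distr M (PiM ?K (\<lambda>_. borel)) (\<lambda>\<omega>. \<lambda>i\<in>?K. ?X i \<omega>)) exp_gaps (\<lambda>z. \<lambda>n\<in>UNIV. z (x, n))"
    by (simp only: eq)
  also have "\<dots> = distr M exp_gaps ((\<lambda>z. \<lambda>n\<in>UNIV. z (x, n)) \<circ> (\<lambda>\<omega>. \<lambda>i\<in>?K. ?X i \<omega>))"
  proof (rule distr_distr)
    have "(\<lambda>z. \<lambda>n\<in>UNIV. z (x, n)) \<in> measurable (PiM ?K (\<lambda>_. borel)) (PiM UNIV (\<lambda>_. borel))"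
      by (intro measurable_restrict measurable_component_singleton) auto
    also have "measurable (PiM ?K (\<lambda>_. borel)) (PiM UNIV (\<lambda>_. borel)) = measurable (PiM ?K (\<lambda>_. borel)) exp_gaps"
      by (intro measurable_cong_sets sets_PiM_cong) auto
    finally show "(\<lambda>z. \<lambda>n\<in>UNIV. z (x, n)) \<in> measurable (PiM ?K (\<lambda>_. borel :: real measure)) exp_gaps" .
    show "(\<lambda>\<omega>. \<lambda>i\<in>?K. ?X i \<omega>) \<in> measurable M (PiM ?K (\<lambda>_. borel))"
      by (intro measurable_restrict rv)
  qed
  also have "((\<lambda>z. \<lambda>n\<in>UNIV. z (x, n)) \<circ> (\<lambda>\<omega>. \<lambda>i\<in>?K. ?X i \<omega>)) = (\<lambda>\<omega> n. X x n \<omega>)"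
    by (auto simp: fun_eq_iff)
  finally show ?thesis by simp
qed

text \<open>Only arrivals count, so the index \<open>0\<close>, which is the time origin, is excluded.\<close>

definition hit_after :: "('v \<Rightarrow> nat \<Rightarrow> 'w \<Rightarrow> real) \<Rightarrow> real \<Rightarrow> 'v \<Rightarrow> real \<Rightarrow> 'w \<Rightarrow> bool" where
  "hit_after X d x a \<omega> \<longleftrightarrow> (\<exists>n\<ge>1. arrival_time X \<omega> x n \<in> {a<..a + d})"

lemma hit_after_measurable:
  assumes P: "poisson_arrivals M V X" and x: "x \<in> V"
  shows "Measurable.pred M (hit_after X d x a)"
proof -
  have [measurable]: "X x n \<in> borel_measurable M" for n
    using P x by (rule poisson_gap_distr)
  show ?thesis unfolding hit_after_def arrival_time_def by measurable
qed

text \<open>Left end points of pairwise disjoint windows \<open>(a, a + d]\<close>. They serve as names of the windows: the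
number of windows is the cardinality of \<open>A\<close>.\<close>

definition separated_starts :: "real \<Rightarrow> real set \<Rightarrow> bool" where
  "separated_starts d A \<longleftrightarrow> finite A \<and> (\<forall>a\<in>A. 0 \<le> a) \<and> (\<forall>a\<in>A. \<forall>b\<in>A. a < b \<longrightarrow> a + d \<le> b)"

lemma separated_starts_subset: "separated_starts d A \<Longrightarrow> B \<subseteq> A \<Longrightarrow> separated_starts d B"
  unfolding separated_starts_def using finite_subset by blast

lemma no_hit_probability:
  assumes P: "poisson_arrivals M V X" and x: "x \<in> V" and d: "0 \<le> d" and A: "separated_starts d A"
  shows "measure M {\<omega> \<in> space M. \<forall>a\<in>A. \<not> hit_after X d x a \<omega>} = exp (- d) ^ card A"
proof -
  interpret prob_space M using P by (simp add: poisson_arrivals_def)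
  let ?U = "\<Union>a\<in>A. {a<..a + d}"
  let ?B = "{s \<in> space exp_gaps. \<forall>k\<ge>1. (\<Sum>i<k. s i) \<notin> ?U}"
  have [measurable]: "X x n \<in> borel_measurable M" for n
    using P x by (rule poisson_gap_distr)
  have seq: "(\<lambda>\<omega> n. X x n \<omega>) \<in> measurable M exp_gaps"
    by (rule measurable_PiM_single') (auto simp: space_PiM)
  have U [measurable]: "?U \<in> sets borel"
    using A by (intro sets.finite_UN) (auto simp: separated_starts_def)
  have B: "?B \<in> sets exp_gaps" by measurable
  have "emeasure M {\<omega> \<in> space M. \<forall>a\<in>A. \<not> hit_after X d x a \<omega>}
      = emeasure M ((\<lambda>\<omega> n. X x n \<omega>) -` ?B \<inter> space M)"
    by (intro arg_cong[where f = "emeasure M"])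
       (auto simp: hit_after_def arrival_time_def space_PiM)
  also have "\<dots> = emeasure (distr M exp_gaps (\<lambda>\<omega> n. X x n \<omega>)) ?B"
    by (rule emeasure_distr[symmetric, OF seq B])
  also have "\<dots> = ennreal (exp (- d * card A))"
    unfolding poisson_sequence_distr[OF P x]
    by (rule avoid_intervals_probability) (use A d in \<open>auto simp: separated_starts_def\<close>)
  also have "exp (- d * card A) = exp (- d) ^ card A"
    by (simp add: exp_of_nat_mult[symmetric] mult.commute)
  finally show ?thesis by (simp add: measure_def)
qed

text \<open>The sites are independent by assumption, and for one site the probability of having no arrival in
any set of windows is the product of the individual probabilities.\<close>

lemma indep_vars_hit_after:
  assumes P: "poisson_arrivals M V X" and d: "0 \<le> d" and A: "separated_starts d A"
  shows "prob_space.indep_vars M (\<lambda>_. count_space UNIV) (\<lambda>(x, a). hit_after X d x a) (V \<times> A)"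
proof -
  interpret prob_space M using P by (simp add: poisson_arrivals_def)
  let ?seq = "\<lambda>x \<omega> n. X x n \<omega>"
  let ?S = "PiM UNIV (\<lambda>_. borel) :: (nat \<Rightarrow> real) measure"
  let ?N = "\<lambda>(x, a). {\<omega> \<in> space M. \<not> hit_after X d x a \<omega>}"
  have iv: "indep_vars (\<lambda>_. borel) (\<lambda>(x, n). X x n) (V \<times> UNIV)"
    using P by (simp add: poisson_arrivals_def)
  have "indep_vars (\<lambda>x. PiM ({x} \<times> UNIV) (\<lambda>_. borel))
      (\<lambda>x \<omega>. \<lambda>i\<in>{x} \<times> UNIV. (\<lambda>(x, n). X x n) i \<omega>) V"
    by (rule indep_vars_restrict[OF iv]) (auto simp: disjoint_family_on_def)
  then have "indep_vars (\<lambda>_. ?S) (\<lambda>x \<omega>. (\<lambda>z n. z (x, n)) (\<lambda>i\<in>{x} \<times> UNIV. (\<lambda>(x, n). X x n) i \<omega>)) V"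
  proof (rule indep_vars_compose2)
    fix x
    show "(\<lambda>z n. z (x, n)) \<in> measurable (PiM ({x} \<times> UNIV) (\<lambda>_. borel)) ?S"
      by (rule measurable_PiM_single') (auto simp: space_PiM)
  qed
  then have seqs: "indep_vars (\<lambda>_. ?S) ?seq V"
    by simp
  have events: "?N i \<in> events" if "i \<in> V \<times> A" for i
    using that hit_after_measurable[OF P, of "fst i" d "snd i"] by (auto simp: split_beta)
  have "indep_events ?N (V \<times> A)"
  proof (rule indep_eventsI[OF events])
    fix J assume J: "J \<subseteq> V \<times> A" "finite J" "J \<noteq> {}"
    let ?J = "\<lambda>x. {a. (x, a) \<in> J}"
    let ?U = "\<lambda>x. \<Union>a\<in>?J x. {a<..a + d}"
    let ?B = "\<lambda>x. {s \<in> space ?S. \<forall>k\<ge>1. (\<Sum>i<k. s i) \<notin> ?U x}"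
    have fin: "finite (?J x)" for x
      by (rule finite_subset[of _ "snd ` J"]) (use J in \<open>auto simp: image_iff\<close>, force)
    have sepJ: "separated_starts d (?J x)" for x
      by (rule separated_starts_subset[OF A]) (use J in auto)
    have B: "?B x \<in> sets ?S" for x
    proof -
      have [measurable]: "?U x \<in> sets borel" using fin by (intro sets.finite_UN) auto
      show ?thesis by measurable
    qed
    have pre: "?seq x -` ?B x \<inter> space M = {\<omega> \<in> space M. \<forall>a\<in>?J x. \<not> hit_after X d x a \<omega>}" for x
      by (auto simp: hit_after_def arrival_time_def space_PiM)
    have "(\<Inter>i\<in>J. ?N i) = (\<Inter>x\<in>fst ` J. ?seq x -` ?B x \<inter> space M)"
    proof (rule set_eqI)
      fix \<omega>
      have 1: "\<omega> \<in> (\<Inter>i\<in>J. ?N i) \<longleftrightarrow> \<omega> \<in> space M \<and> (\<forall>x a. (x, a) \<in> J \<longrightarrow> \<not> hit_after X d x a \<omega>)"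
        using J(3) by fastforce
      have 2: "\<omega> \<in> (\<Inter>x\<in>fst ` J. ?seq x -` ?B x \<inter> space M)
          \<longleftrightarrow> \<omega> \<in> space M \<and> (\<forall>x a. (x, a) \<in> J \<longrightarrow> \<not> hit_after X d x a \<omega>)"
        unfolding pre using J(3) by fastforce
      show "\<omega> \<in> (\<Inter>i\<in>J. ?N i) \<longleftrightarrow> \<omega> \<in> (\<Inter>x\<in>fst ` J. ?seq x -` ?B x \<inter> space M)"
        unfolding 1 2 ..
    qed
    also have "prob \<dots> = (\<Prod>x\<in>fst ` J. prob (?seq x -` ?B x \<inter> space M))"
    proof (rule indep_varsD[OF seqs])
      show "fst ` J \<noteq> {}" "finite (fst ` J)" "fst ` J \<subseteq> V" using J by auto
    qed (rule B)
    also have "\<dots> = (\<Prod>x\<in>fst ` J. \<Prod>a\<in>?J x. exp (- d))"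
    proof (rule prod.cong[OF refl])
      fix x assume "x \<in> fst ` J"
      then have "x \<in> V" using J by auto
      then show "prob (?seq x -` ?B x \<inter> space M) = (\<Prod>a\<in>?J x. exp (- d))"
        unfolding pre using no_hit_probability[OF P _ d sepJ, of x x] by simp
    qed
    also have "\<dots> = (\<Prod>i\<in>Sigma (fst ` J) ?J. exp (- d))"
      using J fin by (subst prod.Sigma) (auto simp: split_beta)
    also have "Sigma (fst ` J) ?J = J"
      by (auto simp: image_iff) force
    also have "(\<Prod>i\<in>J. exp (- d)) = (\<Prod>i\<in>J. prob (?N i))"
    proof (rule prod.cong[OF refl])
      fix i assume "i \<in> J"
      then obtain x a where i: "i = (x, a)" "x \<in> V" "a \<in> A" using J by auto
      have "separated_starts d {a}"
        by (rule separated_starts_subset[OF A]) (use i in auto)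
      from no_hit_probability[OF P i(2) d this] show "exp (- d) = prob (?N i)"
        by (simp add: i)
    qed
    finally show "prob (\<Inter>i\<in>J. ?N i) = (\<Prod>i\<in>J. prob (?N i))" .
  qed
  also have "?N = (\<lambda>i. {\<omega> \<in> space M. \<not> (case i of (x, a) \<Rightarrow> hit_after X d x a) \<omega>})"
    by (auto simp: fun_eq_iff)
  finally show ?thesis
    using hit_after_measurable[OF P] by (intro indep_vars_bool) auto
qed

text \<open>During each window the hit sites form a percolation configuration, and different windows
give independent configurations.\<close>

lemma hit_after_percolation:
  assumes P: "poisson_arrivals M V X" and d: "0 \<le> d" and A: "separated_starts d A"
    and W: "countable W" "W \<subseteq> V" "W \<noteq> {}" and F: "\<F> \<subseteq> {F. finite F \<and> F \<subseteq> W}"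
  defines "p \<equiv> 1 - exp (- d)"
  shows "measure M {\<omega> \<in> space M. \<forall>a\<in>A. \<not> (\<exists>F\<in>\<F>. \<forall>x\<in>F. hit_after X d x a \<omega>)}
    = (1 - measure (site_percolation W p) (contains_some W p \<F>)) ^ card A"
proof (cases "A = {}")
  case True
  interpret prob_space M using P by (simp add: poisson_arrivals_def)
  show ?thesis using True by (simp add: prob_space)
next
  case False
  interpret prob_space M using P by (simp add: poisson_arrivals_def)
  let ?B = "count_space UNIV :: bool measure"
  let ?Y = "\<lambda>(x, a). hit_after X d x a"
  let ?H = "\<lambda>a \<omega>. \<lambda>x\<in>W. hit_after X d x a \<omega>"
  let ?P = "site_percolation W p"
  have p: "0 \<le> p" "p \<le> 1" using d by (auto simp: p_def)
  have iv: "indep_vars (\<lambda>_. ?B) ?Y (W \<times> A)"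
    using indep_vars_hit_after[OF P d A] by (rule indep_vars_subset) (use W in auto)
  have sets_P: "sets ?P = sets (PiM W (\<lambda>_. ?B))"
    unfolding site_percolation_def by (intro sets_PiM_cong) auto
  have sets_C: "contains_some W p \<F> \<in> sets ?P"
    using W F by (intro sets_contains_some) auto
  have rv: "random_variable ?B (hit_after X d x a)" if "x \<in> W" for x a
    using hit_after_measurable[OF P] that W by auto
  have law: "distr M (PiM W (\<lambda>_. ?B)) (?H a) = ?P" if a: "a \<in> A" for a
  proof -
    let ?K = "W \<times> {a}"
    have sep: "separated_starts d {a}"
      by (rule separated_starts_subset[OF A]) (use a in auto)
    have bern: "distr M ?B (hit_after X d x a) = measure_pmf (bernoulli_pmf p)" if x: "x \<in> W" for x
    proof -
      have "x \<in> V" using x W by auto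
      from no_hit_probability[OF P this d sep]
      have no: "prob {\<omega> \<in> space M. \<not> hit_after X d x a \<omega>} = 1 - p"
        by (simp add: p_def)
      have [measurable]: "Measurable.pred M (hit_after X d x a)" by (rule rv[OF x])
      have yes: "prob {\<omega> \<in> space M. hit_after X d x a \<omega>} = p"
        using prob_neg[of "hit_after X d x a"] no by simp
      show ?thesis
      proof (rule measure_eqI_countable[where A = UNIV])
        fix b :: bool
        have "emeasure (distr M ?B (hit_after X d x a)) {b} = ennreal (prob {\<omega> \<in> space M. hit_after X d x a \<omega> = b})"
          by (subst emeasure_distr) (auto simp: emeasure_eq_measure intro!: arg_cong[where f = prob])
        also have "\<dots> = emeasure (measure_pmf (bernoulli_pmf p)) {b}"
          using p yes no by (cases b) (simp_all add: emeasure_pmf_single)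
        finally show "emeasure (distr M ?B (hit_after X d x a)) {b} = emeasure (measure_pmf (bernoulli_pmf p)) {b}" .
      qed auto
    qed
    have "indep_vars (\<lambda>_. ?B) ?Y ?K"
      by (rule indep_vars_subset[OF iv]) (use a in auto)
    then have eq: "distr M (PiM ?K (\<lambda>_. ?B)) (\<lambda>\<omega>. \<lambda>i\<in>?K. ?Y i \<omega>) = PiM ?K (\<lambda>i. distr M ?B (?Y i))"
      using rv W by (subst (asm) indep_vars_iff_distr_eq_PiM') auto
    also have "\<dots> = PiM ?K (\<lambda>_. measure_pmf (bernoulli_pmf p))"
      using bern by (intro PiM_cong) auto
    finally have eq: "distr M (PiM ?K (\<lambda>_. ?B)) (\<lambda>\<omega>. \<lambda>i\<in>?K. ?Y i \<omega>) = PiM ?K (\<lambda>_. measure_pmf (bernoulli_pmf p))" .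
    have "?P = distr (PiM ?K (\<lambda>_. measure_pmf (bernoulli_pmf p))) ?P (\<lambda>z. \<lambda>x\<in>W. z (x, a))"
      unfolding site_percolation_def
      by (rule distr_PiM_reindex[symmetric]) (auto simp: inj_on_def measure_pmf.prob_space_axioms)
    also have "\<dots> = distr (distr M (PiM ?K (\<lambda>_. ?B)) (\<lambda>\<omega>. \<lambda>i\<in>?K. ?Y i \<omega>)) (PiM W (\<lambda>_. ?B)) (\<lambda>z. \<lambda>x\<in>W. z (x, a))"
      unfolding eq by (rule distr_cong) (simp_all add: sets_P)
    also have "\<dots> = distr M (PiM W (\<lambda>_. ?B)) ((\<lambda>z. \<lambda>x\<in>W. z (x, a)) \<circ> (\<lambda>\<omega>. \<lambda>i\<in>?K. ?Y i \<omega>))"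
    proof (rule distr_distr)
      show "(\<lambda>z. \<lambda>x\<in>W. z (x, a)) \<in> measurable (PiM ?K (\<lambda>_. ?B)) (PiM W (\<lambda>_. ?B))"
        by (intro measurable_restrict measurable_component_singleton) auto
      show "(\<lambda>\<omega>. \<lambda>i\<in>?K. ?Y i \<omega>) \<in> measurable M (PiM ?K (\<lambda>_. ?B))"
        using rv by (intro measurable_restrict) auto
    qed
    also have "((\<lambda>z. \<lambda>x\<in>W. z (x, a)) \<circ> (\<lambda>\<omega>. \<lambda>i\<in>?K. ?Y i \<omega>)) = ?H a"
      by (auto simp: fun_eq_iff)
    finally show ?thesis by (rule sym)
  qed
  have indep: "indep_vars (\<lambda>_. PiM W (\<lambda>_. ?B)) ?H A"
  proof -
    have "indep_vars (\<lambda>a. PiM (W \<times> {a}) (\<lambda>_. ?B)) (\<lambda>a \<omega>. \<lambda>i\<in>W \<times> {a}. ?Y i \<omega>) A"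
      by (rule indep_vars_restrict[OF iv]) (auto simp: disjoint_family_on_def)
    then have "indep_vars (\<lambda>_. PiM W (\<lambda>_. ?B)) (\<lambda>a \<omega>. (\<lambda>z. \<lambda>x\<in>W. z (x, a)) (\<lambda>i\<in>W \<times> {a}. ?Y i \<omega>)) A"
    proof (rule indep_vars_compose2)
      fix a
      show "(\<lambda>z. \<lambda>x\<in>W. z (x, a)) \<in> measurable (PiM (W \<times> {a}) (\<lambda>_. ?B)) (PiM W (\<lambda>_. ?B))"
        by (intro measurable_restrict measurable_component_singleton) auto
    qed
    also have "(\<lambda>a \<omega>. (\<lambda>z. \<lambda>x\<in>W. z (x, a)) (\<lambda>i\<in>W \<times> {a}. ?Y i \<omega>)) = ?H"
      by (auto simp: fun_eq_iff)
    finally show ?thesis .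
  qed
  let ?D = "space ?P - contains_some W p \<F>"
  have D: "?D \<in> sets (PiM W (\<lambda>_. ?B))" using sets_C unfolding sets_P[symmetric] by auto
  have "{\<omega> \<in> space M. \<forall>a\<in>A. \<not> (\<exists>F\<in>\<F>. \<forall>x\<in>F. hit_after X d x a \<omega>)}
      = (\<Inter>a\<in>A. ?H a -` ?D \<inter> space M)"
  proof -
    have sub: "F \<subseteq> W" if "F \<in> \<F>" for F using that F by auto
    have "?H a \<omega> \<in> contains_some W p \<F> \<longleftrightarrow> (\<exists>F\<in>\<F>. \<forall>x\<in>F. hit_after X d x a \<omega>)" for a \<omega>
      unfolding contains_some_def occupied_sites_def space_site_percolation
      using sub by (auto simp: subset_iff)
    moreover have "?H a \<omega> \<in> space ?P" for a \<omega>
      by (simp add: space_site_percolation)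
    ultimately have "?H a \<omega> \<in> ?D \<longleftrightarrow> \<not> (\<exists>F\<in>\<F>. \<forall>x\<in>F. hit_after X d x a \<omega>)" for a \<omega>
      by simp
    then show ?thesis using False by auto
  qed
  also have "prob \<dots> = (\<Prod>a\<in>A. prob (?H a -` ?D \<inter> space M))"
    by (rule indep_varsD[OF indep]) (use False A D in \<open>auto simp: separated_starts_def\<close>)
  also have "\<dots> = (\<Prod>a\<in>A. 1 - measure ?P (contains_some W p \<F>))"
  proof (rule prod.cong[OF refl])
    fix a assume a: "a \<in> A"
    interpret P: prob_space ?P by (rule prob_space_site_percolation)
    have "prob (?H a -` ?D \<inter> space M) = measure (distr M (PiM W (\<lambda>_. ?B)) (?H a)) ?D"
      by (rule measure_distr[symmetric, OF _ D]) (intro measurable_restrict rv)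
    also have "\<dots> = 1 - measure ?P (contains_some W p \<F>)"
      unfolding law[OF a] by (rule P.prob_compl[OF sets_C])
    finally show "prob (?H a -` ?D \<inter> space M) = 1 - measure ?P (contains_some W p \<F>)" .
  qed
  finally show ?thesis by simp
qed

section \<open>The exponential bound for the gaps at the origin\<close>

text \<open>Multiplying the standard exponential density by \<open>e\<^bsup>l u\<^esup>\<close> gives \<open>1 / (1 - l)\<close> times the exponential
density of rate \<open>1 - l\<close>, under which a gap exceeds \<open>d\<close> with probability \<open>e\<^bsup>-(1 - l) d\<^esup>\<close>. Under this
law the mean of the weight is \<open>1 - (1 - \<gamma>) e\<^bsup>-(1 - l) d\<^esup>\<close>, which the equation for \<open>l\<close> turns into \<open>1 - l\<close>.\<close>

lemma nn_integral_tilted_weight: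
  fixes l d \<gamma> :: real
  assumes l: "l < 1" and d: "0 \<le> d" and \<gamma>: "0 \<le> \<gamma>" "\<gamma> \<le> 1"
    and root: "l = (1 - \<gamma>) * exp (- (1 - l) * d)"
  shows "(\<integral>\<^sup>+u. ennreal ((if d < u then \<gamma> else 1) * exp (l * u)) \<partial>std_exp) = 1"
proof -
  define \<mu> where "\<mu> = 1 - l"
  have \<mu>: "0 < \<mu>" using l by (simp add: \<mu>_def)
  let ?D = "exponential_density \<mu>"
  have D: "0 \<le> ?D u" for u using \<mu> by (rule exponential_density_nonneg)
  have "(\<integral>\<^sup>+u. ennreal ((if d < u then \<gamma> else 1) * exp (l * u)) \<partial>std_exp)
      = (\<integral>\<^sup>+u. ennreal (exponential_density 1 u) * ennreal ((if d < u then \<gamma> else 1) * exp (l * u)) \<partial>lborel)"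
    by (rule nn_integral_std_exp) measurable
  also have "\<dots> = (\<integral>\<^sup>+u. ennreal (\<gamma> / \<mu>) * ennreal (?D u)
      + ennreal ((1 - \<gamma>) / \<mu>) * (ennreal (?D u) * indicator {..d} u) \<partial>lborel)"
  proof (rule nn_integral_cong)
    fix u :: real
    have "exponential_density 1 u * exp (l * u) = ?D u / \<mu>"
    proof -
      have "exp (- u * 1) * exp (l * u) = exp (- u * \<mu>)"
        unfolding exp_add[symmetric] by (simp add: \<mu>_def algebra_simps)
      then show ?thesis using \<mu> by (simp add: exponential_density_def)
    qed
    then have eq: "exponential_density 1 u * ((if d < u then \<gamma> else 1) * exp (l * u))
        = \<gamma> / \<mu> * ?D u + (1 - \<gamma>) / \<mu> * (?D u * indicator {..d} u)"
      using \<mu> by (auto simp: field_simps)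
    have "ennreal (exponential_density 1 u) * ennreal ((if d < u then \<gamma> else 1) * exp (l * u))
        = ennreal (exponential_density 1 u * ((if d < u then \<gamma> else 1) * exp (l * u)))"
      using \<gamma> by (intro ennreal_mult[symmetric] exponential_density_nonneg) auto
    also have "\<dots> = ennreal (\<gamma> / \<mu> * ?D u) + ennreal ((1 - \<gamma>) / \<mu> * (?D u * indicator {..d} u))"
      unfolding eq using \<mu> \<gamma> D[of u] by (intro ennreal_plus) auto
    also have "\<dots> = ennreal (\<gamma> / \<mu>) * ennreal (?D u)
        + ennreal ((1 - \<gamma>) / \<mu>) * (ennreal (?D u) * indicator {..d} u)"
    proof -
      have 1: "ennreal (\<gamma> / \<mu> * ?D u) = ennreal (\<gamma> / \<mu>) * ennreal (?D u)"
        using \<mu> \<gamma> D by (intro ennreal_mult) auto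
      have 2: "ennreal ((1 - \<gamma>) / \<mu> * (?D u * indicator {..d} u))
          = ennreal ((1 - \<gamma>) / \<mu>) * ennreal (?D u * indicator {..d} u)"
        using \<mu> \<gamma> D by (intro ennreal_mult) auto
      have 3: "ennreal (?D u * indicator {..d} u) = ennreal (?D u) * indicator {..d} u"
        by (simp add: indicator_def)
      show ?thesis unfolding 1 2 3 ..
    qed
    finally show "ennreal (exponential_density 1 u) * ennreal ((if d < u then \<gamma> else 1) * exp (l * u))
        = ennreal (\<gamma> / \<mu>) * ennreal (?D u)
        + ennreal ((1 - \<gamma>) / \<mu>) * (ennreal (?D u) * indicator {..d} u)" .
  qed
  also have "\<dots> = ennreal (\<gamma> / \<mu>) * (\<integral>\<^sup>+u. ennreal (?D u) \<partial>lborel)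
      + ennreal ((1 - \<gamma>) / \<mu>) * (\<integral>\<^sup>+u. ennreal (?D u) * indicator {..d} u \<partial>lborel)"
    by (simp add: nn_integral_add nn_integral_cmult)
  also have "(\<integral>\<^sup>+u. ennreal (?D u) \<partial>lborel) = 1"
  proof -
    interpret prob_space "density lborel ?D" using \<mu> by (rule prob_space_exponential_density)
    show ?thesis using emeasure_space_1 by (simp add: emeasure_density)
  qed
  also have "(\<integral>\<^sup>+u. ennreal (?D u) * indicator {..d} u \<partial>lborel) = ennreal (1 - exp (- \<mu> * d))"
  proof -
    have "(\<integral>\<^sup>+u. ennreal (?D u) * indicator {..d} u \<partial>lborel) = emeasure (density lborel ?D) {..d}"
      by (simp add: emeasure_density)
    also have "\<dots> = ennreal (erlang_CDF 0 \<mu> d)"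
      using \<mu> d by (intro emeasure_erlang_density) auto
    finally show ?thesis using d by (simp add: erlang_CDF_0)
  qed
  also have "ennreal (\<gamma> / \<mu>) * 1 + ennreal ((1 - \<gamma>) / \<mu>) * ennreal (1 - exp (- \<mu> * d))
      = ennreal (\<gamma> / \<mu> + (1 - \<gamma>) / \<mu> * (1 - exp (- \<mu> * d)))"
    using \<mu> \<gamma> d by (subst ennreal_mult[symmetric]) auto
  also have "\<gamma> / \<mu> + (1 - \<gamma>) / \<mu> * (1 - exp (- \<mu> * d)) = 1"
  proof -
    have "\<gamma> / \<mu> + (1 - \<gamma>) / \<mu> * (1 - exp (- \<mu> * d)) = (1 - (1 - \<gamma>) * exp (- \<mu> * d)) / \<mu>"
      using \<mu> by (simp add: field_simps)
    also have "(1 - \<gamma>) * exp (- \<mu> * d) = l" using root by (simp add: \<mu>_def)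
    finally show ?thesis using \<mu> by (simp add: \<mu>_def)
  qed
  finally show ?thesis by simp
qed

text \<open>The power of \<open>\<gamma>\<close> whose exponent counts the gaps among the first \<open>n\<close> that are longer than \<open>d\<close> and
completed by time \<open>x\<close>.\<close>

definition failure_weight :: "real \<Rightarrow> real \<Rightarrow> nat \<Rightarrow> real \<Rightarrow> (nat \<Rightarrow> real) \<Rightarrow> real" where
  "failure_weight \<gamma> d n x y = (\<Prod>i<n. if (\<Sum>k<Suc i. y k) \<le> x \<and> d < y i then \<gamma> else 1)"

lemma failure_weight_case_nat:
  "failure_weight \<gamma> d (Suc n) x (case_nat u y)
    = (if u \<le> x \<and> d < u then \<gamma> else 1) * failure_weight \<gamma> d n (x - u) y"
proof -
  have "failure_weight \<gamma> d (Suc n) x (case_nat u y)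
      = (if u \<le> x \<and> d < u then \<gamma> else 1) *
        (\<Prod>i<n. if u + (\<Sum>k<Suc i. y k) \<le> x \<and> d < y i then \<gamma> else 1)"
    unfolding failure_weight_def sum_case_nat by (subst prod.lessThan_Suc_shift) simp
  also have "(\<Prod>i<n. if u + (\<Sum>k<Suc i. y k) \<le> x \<and> d < y i then \<gamma> else 1)
      = failure_weight \<gamma> d n (x - u) y"
    unfolding failure_weight_def by (intro prod.cong refl if_cong) (auto simp: algebra_simps)
  finally show ?thesis .
qed

lemma failure_weight_bounds:
  assumes "0 \<le> \<gamma>" "\<gamma> \<le> 1"
  shows "0 \<le> failure_weight \<gamma> d n x y" "failure_weight \<gamma> d n x y \<le> 1"
  unfolding failure_weight_def using assms by (auto intro!: prod_nonneg prod_le_1)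

lemma failure_weight_measurable [measurable]:
  "failure_weight \<gamma> d n x \<in> borel_measurable exp_gaps"
  unfolding failure_weight_def by measurable

text \<open>First-step analysis in place of optional stopping. If the first gap \<open>u\<close> ends by time \<open>x\<close>, its weight
times the bound for the remaining time \<open>x - u\<close> is at most the integrand of the tilted mean. If it
passes \<open>x\<close>, the product of the weights is at most \<open>1\<close>, and \<open>\<gamma>\<^bsup>-1\<^esup> w(u) e\<^bsup>l (u - x)\<^esup> \<ge> 1\<close>: this is where the factor
\<open>\<gamma>\<^bsup>-1\<^esup>\<close> is spent. The term \<open>e\<^sup>x 2\<^bsup>-n\<^esup>\<close> bounds the probability that the first \<open>n\<close> gaps
all end by time \<open>x\<close>, and disappears as \<open>n\<close> grows.\<close>

lemma expected_failure_weight_le: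
  fixes l d \<gamma> :: real
  assumes \<gamma>: "0 < \<gamma>" "\<gamma> \<le> 1" and l: "0 \<le> l" and x: "0 \<le> x"
    and tilt: "(\<integral>\<^sup>+u. ennreal ((if d < u then \<gamma> else 1) * exp (l * u)) \<partial>std_exp) = 1"
  shows "(\<integral>\<^sup>+y. ennreal (failure_weight \<gamma> d n x y) \<partial>exp_gaps)
    \<le> ennreal (inverse \<gamma> * exp (- l * x) + exp x * (1 / 2) ^ n)"
  using x
proof (induction n arbitrary: x)
  case 0
  interpret prob_space exp_gaps by (rule prob_space_exp_gaps)
  have "1 \<le> exp x" using 0 by simp
  moreover have "0 \<le> inverse \<gamma> * exp (- l * x)" using \<gamma> by simp
  ultimately have "1 \<le> inverse \<gamma> * exp (- l * x) + exp x" by linarith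
  from ennreal_leI[OF this] show ?case by (simp add: failure_weight_def emeasure_space_1)
next
  case (Suc n)
  interpret S: prob_space exp_gaps by (rule prob_space_exp_gaps)
  let ?w = "\<lambda>u. if d < u then \<gamma> else 1"
  let ?a = "inverse \<gamma> * exp (- l * x)" and ?b = "exp x * (1 / 2) ^ n"
  have ab: "0 \<le> ?a" "0 \<le> ?b" using \<gamma> by auto
  have w: "0 \<le> ?w u" "?w u \<le> 1" "\<gamma> \<le> ?w u" for u using \<gamma> by auto
  have step: "(\<integral>\<^sup>+y. ennreal (failure_weight \<gamma> d (Suc n) x (case_nat u y)) \<partial>exp_gaps)
      \<le> ennreal ?a * ennreal (?w u * exp (l * u)) + ennreal ?b * ennreal (exp (- u))"
    if u: "0 < u" for u
  proof -
    have rhs: "ennreal ?a * ennreal (?w u * exp (l * u)) + ennreal ?b * ennreal (exp (- u))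
        = ennreal (?a * (?w u * exp (l * u)) + ?b * exp (- u))"
      using ab w[of u] by (simp add: ennreal_mult ennreal_plus)
    show ?thesis
    proof (cases "u \<le> x")
      case True
      have "(\<integral>\<^sup>+y. ennreal (failure_weight \<gamma> d (Suc n) x (case_nat u y)) \<partial>exp_gaps)
          = (\<integral>\<^sup>+y. ennreal (?w u) * ennreal (failure_weight \<gamma> d n (x - u) y) \<partial>exp_gaps)"
        using True w[of u] failure_weight_bounds[of \<gamma> d n "x - u"] \<gamma>
        by (intro nn_integral_cong) (simp add: failure_weight_case_nat ennreal_mult)
      also have "\<dots> = ennreal (?w u) * (\<integral>\<^sup>+y. ennreal (failure_weight \<gamma> d n (x - u) y) \<partial>exp_gaps)"
        by (rule nn_integral_cmult) measurable
      also have "\<dots> \<le> ennreal (?w u) * ennreal (inverse \<gamma> * exp (- l * (x - u)) + exp (x - u) * (1 / 2) ^ n)"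
        using True by (intro mult_left_mono Suc.IH) auto
      also have "\<dots> = ennreal (?w u * (inverse \<gamma> * exp (- l * (x - u)) + exp (x - u) * (1 / 2) ^ n))"
        using w[of u] \<gamma> by (intro ennreal_mult[symmetric]) auto
      also have "\<dots> \<le> ennreal (?a * (?w u * exp (l * u)) + ?b * exp (- u))"
      proof (rule ennreal_leI)
        have 1: "exp (- l * (x - u)) = exp (- l * x) * exp (l * u)"
          by (simp add: exp_add[symmetric] algebra_simps)
        have 2: "exp (x - u) = exp x * exp (- u)" by (simp add: exp_add[symmetric])
        have "?w u * (exp x * exp (- u) * (1 / 2) ^ n) \<le> 1 * (exp x * exp (- u) * (1 / 2) ^ n)"
          using w[of u] by (intro mult_right_mono) auto
        then show "?w u * (inverse \<gamma> * exp (- l * (x - u)) + exp (x - u) * (1 / 2) ^ n)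
            \<le> ?a * (?w u * exp (l * u)) + ?b * exp (- u)"
          unfolding 1 2 by (simp add: algebra_simps)
      qed
      finally show ?thesis unfolding rhs .
    next
      case False
      have "(\<integral>\<^sup>+y. ennreal (failure_weight \<gamma> d (Suc n) x (case_nat u y)) \<partial>exp_gaps)
          \<le> (\<integral>\<^sup>+y. 1 \<partial>exp_gaps)"
        using failure_weight_bounds[of \<gamma> d "Suc n" x] \<gamma> by (intro nn_integral_mono) auto
      also have "\<dots> = 1" by (simp add: S.emeasure_space_1)
      also have "1 \<le> ennreal (?a * (?w u * exp (l * u)) + ?b * exp (- u))"
      proof -
        have "0 \<le> l * (u - x)" using False l by simp
        then have "1 \<le> exp (l * (u - x))" by simp
        moreover have "1 \<le> inverse \<gamma> * ?w u"
          using w(3)[of u] \<gamma> by (simp add: field_simps)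
        ultimately have "1 * 1 \<le> (inverse \<gamma> * ?w u) * exp (l * (u - x))"
          using \<gamma> by (intro mult_mono) auto
        also have "\<dots> = ?a * (?w u * exp (l * u))"
          by (simp add: exp_add[symmetric] algebra_simps exp_diff exp_minus divide_inverse)
        also have "\<dots> \<le> ?a * (?w u * exp (l * u)) + ?b * exp (- u)"
          by simp
        finally show ?thesis by simp
      qed
      finally show ?thesis unfolding rhs .
    qed
  qed
  have "(\<integral>\<^sup>+y. ennreal (failure_weight \<gamma> d (Suc n) x y) \<partial>exp_gaps)
      = (\<integral>\<^sup>+u. \<integral>\<^sup>+y. ennreal (failure_weight \<gamma> d (Suc n) x (case_nat u y)) \<partial>exp_gaps \<partial>std_exp)"
    by (rule nn_integral_exp_gaps_peel) measurable
  also have "\<dots> \<le> (\<integral>\<^sup>+u. ennreal ?a * ennreal (?w u * exp (l * u)) + ennreal ?b * ennreal (exp (- u)) \<partial>std_exp)"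
    by (rule nn_integral_mono_AE, use AE_std_exp_pos in eventually_elim) (rule step)
  also have "\<dots> = ennreal ?a * (\<integral>\<^sup>+u. ennreal (?w u * exp (l * u)) \<partial>std_exp)
      + ennreal ?b * (\<integral>\<^sup>+u. ennreal (exp (- u)) \<partial>std_exp)"
    by (simp add: nn_integral_add nn_integral_cmult)
  also have "\<dots> = ennreal ?a * 1 + ennreal ?b * ennreal (1 / 2)"
    by (simp only: tilt nn_integral_std_exp_exp_minus)
  also have "\<dots> = ennreal ?a + ennreal (?b * (1 / 2))"
    using ab by (subst ennreal_mult[symmetric]) auto
  also have "\<dots> = ennreal (?a + exp x * (1 / 2) ^ Suc n)"
    using ab by (subst ennreal_plus[symmetric]) auto
  finally show ?case .
qed

section \<open>Survival given the arrivals at the origin\<close>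

lemma separated_arrivals:
  fixes y :: "nat \<Rightarrow> real"
  assumes pos: "\<And>k. 0 < y k" and I: "finite I" "\<And>i. i \<in> I \<Longrightarrow> d < y i"
  shows "separated_starts d ((\<lambda>i. \<Sum>k<i. y k) ` I)" and "inj_on (\<lambda>i. \<Sum>k<i. y k) I"
proof -
  let ?S = "\<lambda>i. \<Sum>k<i. y k"
  have mono: "strict_mono ?S"
    unfolding strict_mono_Suc_iff using pos by simp
  then show "inj_on ?S I" using strict_mono_imp_inj_on inj_on_subset by blast
  have "?S i + d \<le> ?S j" if "i \<in> I" "?S i < ?S j" for i j
  proof -
    have "i < j" using that(2) strict_mono_less[OF mono, of i j] by simp
    then have "?S (Suc i) \<le> ?S j" using strict_mono_less_eq[OF mono, of "Suc i" j] by simp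
    then show ?thesis using I(2)[OF that(1)] by simp
  qed
  moreover have "0 \<le> ?S i" for i using pos by (intro sum_nonneg) (auto intro: less_imp_le)
  ultimately show "separated_starts d (?S ` I)"
    using I(1) by (auto simp: separated_starts_def)
qed

text \<open>Here \<open>y\<close> is a fixed sequence of gaps at the origin. The windows are the initial
pieces of length \<open>d\<close> of the gaps longer than \<open>d\<close>; they lie inside these gaps and are therefore
disjoint, and each of them fails to connect the two sites independently with probability at most \<open>\<gamma>\<close>.\<close>

lemma survival_given_origin_arrivals:
  assumes P: "poisson_arrivals M V X" and d: "0 \<le> d"
    and W: "countable W" "W \<subseteq> V" "W \<noteq> {}" and F: "\<F> \<subseteq> {F. finite F \<and> F \<subseteq> W}"
    and \<gamma>: "1 - measure (site_percolation W (1 - exp (- d))) (contains_some W (1 - exp (- d)) \<F>) \<le> \<gamma>"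
    and pos: "\<And>k. 0 < y k"
  shows "measure M {\<omega> \<in> space M. \<forall>i<n. (\<Sum>k<Suc i. y k) \<le> x \<and> d < y i \<longrightarrow>
      \<not> (\<exists>F\<in>\<F>. \<forall>s\<in>F. hit_after X d s (\<Sum>k<i. y k) \<omega>)}
    \<le> failure_weight \<gamma> d n x y"
proof -
  let ?S = "\<lambda>i. \<Sum>k<i. y k"
  define I where "I = {i \<in> {..<n}. ?S (Suc i) \<le> x \<and> d < y i}"
  have fin: "finite I" and gap: "\<And>i. i \<in> I \<Longrightarrow> d < y i" by (auto simp: I_def)
  have sep: "separated_starts d (?S ` I)" "inj_on ?S I"
    by (rule separated_arrivals; fact pos fin gap)+
  let ?Q = "\<lambda>a \<omega>. \<exists>F\<in>\<F>. \<forall>s\<in>F. hit_after X d s a \<omega>"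
  let ?c = "measure (site_percolation W (1 - exp (- d))) (contains_some W (1 - exp (- d)) \<F>)"
  interpret P: prob_space "site_percolation W (1 - exp (- d))" by (rule prob_space_site_percolation)
  have "{\<omega> \<in> space M. \<forall>i<n. ?S (Suc i) \<le> x \<and> d < y i \<longrightarrow> \<not> ?Q (?S i) \<omega>}
      = {\<omega> \<in> space M. \<forall>a\<in>?S ` I. \<not> ?Q a \<omega>}"
    by (auto simp: I_def)
  also have "measure M \<dots> = (1 - ?c) ^ card (?S ` I)"
    by (rule hit_after_percolation[OF P d sep(1) W F])
  also have "\<dots> \<le> \<gamma> ^ card (?S ` I)"
    using \<gamma> by (intro power_mono) auto
  also have "card (?S ` I) = card I" by (rule card_image[OF sep(2)])
  also have "\<gamma> ^ card I = failure_weight \<gamma> d n x y"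
    unfolding failure_weight_def I_def
    by (subst prod.If_cases) (auto simp: Collect_conj_eq lessThan_def)
  finally show ?thesis .
qed

text \<open>The arrivals at the origin are independent of those at the other sites, so the bound for a
fixed sequence of gaps may be integrated over their law.\<close>

lemma survival_probability_le:
  fixes M :: "'w measure" and X :: "'v \<Rightarrow> nat \<Rightarrow> 'w \<Rightarrow> real" and x d \<gamma> :: real and n :: nat
  assumes P: "poisson_arrivals M V X" and d: "0 \<le> d" and v0: "v0 \<in> V" and V: "countable V"
    and W: "W = V - {v0}" "W \<noteq> {}" and F: "\<F> \<subseteq> {F. finite F \<and> F \<subseteq> W}"
    and \<gamma>: "1 - measure (site_percolation W (1 - exp (- d))) (contains_some W (1 - exp (- d)) \<F>) \<le> \<gamma>"
  defines "B \<equiv> {\<omega> \<in> space M. \<forall>i<n. arrival_time X \<omega> v0 (Suc i) \<le> x \<and> d < X v0 i \<omega> \<longrightarrow>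
      \<not> (\<exists>F\<in>\<F>. \<forall>s\<in>F. hit_after X d s (arrival_time X \<omega> v0 i) \<omega>)}"
  shows "B \<in> sets M"
    and "emeasure M B \<le> (\<integral>\<^sup>+y. ennreal (failure_weight \<gamma> d n x y) \<partial>exp_gaps)"
proof -
  interpret prob_space M using P by (simp add: poisson_arrivals_def)
  \<comment> \<open>\<open>indep_var\<close> pairs variables with values in one type; so both families are first indexed by
    \<open>'v \<times> nat\<close>, and the one at the origin is turned into a sequence afterwards\<close>
  let ?O = "{v0} \<times> (UNIV :: nat set)" and ?K = "W \<times> (UNIV :: nat set)"
  let ?N = "PiM ?K (\<lambda>_. borel) :: ('v \<times> nat \<Rightarrow> real) measure"
  let ?X = "\<lambda>(x, n). X x n"
  let ?Y = "\<lambda>\<omega> n. X v0 n \<omega>" and ?Z = "\<lambda>\<omega>. \<lambda>i\<in>?K. ?X i \<omega>"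
  have "indep_vars (\<lambda>_. borel) ?X (V \<times> UNIV)"
    using P by (simp add: poisson_arrivals_def)
  then have iv: "indep_var (PiM ?O (\<lambda>_. borel)) (\<lambda>\<omega>. \<lambda>i\<in>?O. ?X i \<omega>) ?N ?Z"
  proof (rule indep_var_restrict)
    show "?O \<inter> ?K = {}" "?O \<subseteq> V \<times> UNIV" "?K \<subseteq> V \<times> UNIV" using W(1) v0 by auto
  qed
  let ?L = "PiM ?O (\<lambda>_. borel) :: ('v \<times> nat \<Rightarrow> real) measure"
  let ?Y' = "\<lambda>\<omega>. \<lambda>i\<in>?O. ?X i \<omega>" and ?f = "\<lambda>(z :: 'v \<times> nat \<Rightarrow> real) n. z (v0, n)"
  have Y'm: "?Y' \<in> measurable M ?L" and Zm: "?Z \<in> measurable M ?N"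
    and joint: "distr M ?L ?Y' \<Otimes>\<^sub>M distr M ?N ?Z = distr M (?L \<Otimes>\<^sub>M ?N) (\<lambda>\<omega>. (?Y' \<omega>, ?Z \<omega>))"
    using iv by (simp_all add: indep_var_distribution_eq)
  have fm: "?f \<in> measurable ?L exp_gaps"
    by (rule measurable_PiM_single') (auto simp: space_PiM)
  have Ym: "?Y \<in> measurable M exp_gaps"
    using measurable_compose[OF Y'm fm] by simp
  interpret Z: prob_space "distr M ?N ?Z" by (rule prob_space_distr[OF Zm])
  have eq: "exp_gaps \<Otimes>\<^sub>M distr M ?N ?Z = distr M (exp_gaps \<Otimes>\<^sub>M ?N) (\<lambda>\<omega>. (?Y \<omega>, ?Z \<omega>))"
  proof -
    have "exp_gaps = distr (distr M ?L ?Y') exp_gaps ?f"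
      using poisson_sequence_distr[OF P v0] distr_distr[OF fm Y'm] by (simp add: comp_def)
    moreover have "distr M ?N ?Z = distr (distr M ?N ?Z) ?N (\<lambda>z. z)"
      by (rule distr_id2[symmetric]) simp
    ultimately have "exp_gaps \<Otimes>\<^sub>M distr M ?N ?Z
        = distr (distr M ?L ?Y') exp_gaps ?f \<Otimes>\<^sub>M distr (distr M ?N ?Z) ?N (\<lambda>z. z)"
      by simp
    also have "\<dots> = distr (distr M ?L ?Y' \<Otimes>\<^sub>M distr M ?N ?Z) (exp_gaps \<Otimes>\<^sub>M ?N) (\<lambda>(y, z). (?f y, z))"
      by (rule pair_measure_distr)
         (use fm Z.sigma_finite_measure_axioms in \<open>simp_all add: distr_id2\<close>)
    also have "\<dots> = distr M (exp_gaps \<Otimes>\<^sub>M ?N) ((\<lambda>(y, z). (?f y, z)) \<circ> (\<lambda>\<omega>. (?Y' \<omega>, ?Z \<omega>)))"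
      unfolding joint
    proof (rule distr_distr)
      show "(\<lambda>(y, z). (?f y, z)) \<in> measurable (?L \<Otimes>\<^sub>M ?N) (exp_gaps \<Otimes>\<^sub>M ?N)"
        unfolding split_beta
        by (intro measurable_Pair measurable_compose[OF measurable_fst fm] measurable_snd)
      show "(\<lambda>\<omega>. (?Y' \<omega>, ?Z \<omega>)) \<in> measurable M (?L \<Otimes>\<^sub>M ?N)"
        by (rule measurable_Pair[OF Y'm Zm])
    qed
    also have "(\<lambda>(y, z). (?f y, z)) \<circ> (\<lambda>\<omega>. (?Y' \<omega>, ?Z \<omega>)) = (\<lambda>\<omega>. (?Y \<omega>, ?Z \<omega>))"
      by (auto simp: fun_eq_iff)
    finally show ?thesis .
  qed
  let ?S = "\<lambda>y i. \<Sum>k<i. y k :: real"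
  define G where "G a z \<longleftrightarrow> (\<exists>F\<in>\<F>. \<forall>s\<in>F. \<exists>m. 1 \<le> m \<and> (\<Sum>k<m. z (s, k)) \<in> {a<..a + d})"
    for a and z :: "'v \<times> nat \<Rightarrow> real"
  have G: "G a (?Z \<omega>) \<longleftrightarrow> (\<exists>F\<in>\<F>. \<forall>s\<in>F. hit_after X d s a \<omega>)" for a \<omega>
    unfolding G_def
  proof (rule bex_cong[OF refl], rule ball_cong[OF refl])
    fix F s assume "F \<in> \<F>" "s \<in> F"
    then have "s \<in> W" using F by auto
    then show "(\<exists>m. 1 \<le> m \<and> (\<Sum>k<m. ?Z \<omega> (s, k)) \<in> {a<..a + d}) \<longleftrightarrow> hit_after X d s a \<omega>"
      by (auto simp: hit_after_def arrival_time_def)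
  qed
  let ?R = "exp_gaps \<Otimes>\<^sub>M ?N"
  let ?B = "{yz \<in> space ?R. \<forall>i\<in>{..<n}. ?S (fst yz) (Suc i) \<le> x \<and> d < fst yz i \<longrightarrow> \<not> G (?S (fst yz) i) (snd yz)}"
  have "countable {F. finite F \<and> F \<subseteq> W}"
    by (rule countable_Collect_finite_subset) (use V W in auto)
  then have cF: "countable \<F>" using F countable_subset by blast
  have B_sets: "?B \<in> sets ?R"
  proof (intro sets.sets_Collect_finite_All sets.sets_Collect_imp sets.sets_Collect_neg finite_lessThan)
    fix i
    show "{yz \<in> space ?R. ?S (fst yz) (Suc i) \<le> x \<and> d < fst yz i} \<in> sets ?R"
      by measurable
    show "{yz \<in> space ?R. G (?S (fst yz) i) (snd yz)} \<in> sets ?R"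
      unfolding G_def
    proof (intro sets.sets_Collect_countable_Ex' sets.sets_Collect_finite_All sets.sets_Collect_countable_Ex
        sets.sets_Collect_conj cF)
      fix F s m assume Fs: "F \<in> \<F>" "s \<in> F"
      then have [measurable]: "(\<lambda>yz. snd yz (s, k)) \<in> borel_measurable ?R" for k
        using F by (intro measurable_compose[OF measurable_snd] measurable_component_singleton) auto
      show "{yz \<in> space ?R. (\<Sum>k<m. snd yz (s, k)) \<in> {?S (fst yz) i<..?S (fst yz) i + d}} \<in> sets ?R"
        unfolding greaterThanAtMost_iff by measurable
    qed (use F in auto)
  qed
  have B_eq: "B = (\<lambda>\<omega>. (?Y \<omega>, ?Z \<omega>)) -` ?B \<inter> space M"
    using measurable_space[OF Ym] measurable_space[OF Zm]
    by (auto simp: B_def G arrival_time_def space_pair_measure)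
  have YZ: "(\<lambda>\<omega>. (?Y \<omega>, ?Z \<omega>)) \<in> measurable M ?R"
    using Ym Zm by (rule measurable_Pair)
  show "B \<in> sets M" unfolding B_eq by (rule measurable_sets[OF YZ B_sets])
  have "emeasure M B = emeasure (exp_gaps \<Otimes>\<^sub>M distr M ?N ?Z) ?B"
    unfolding eq B_eq by (rule emeasure_distr[symmetric, OF YZ B_sets])
  also have "\<dots> = (\<integral>\<^sup>+y. emeasure (distr M ?N ?Z) (Pair y -` ?B) \<partial>exp_gaps)"
    by (rule Z.emeasure_pair_measure_alt) (use B_sets in simp)
  also have "\<dots> \<le> (\<integral>\<^sup>+y. ennreal (failure_weight \<gamma> d n x y) \<partial>exp_gaps)"
  proof (rule nn_integral_mono_AE, use AE_exp_gaps_pos AE_space in eventually_elim)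
    fix y :: "nat \<Rightarrow> real" assume pos: "\<forall>k. 0 < y k" and y: "y \<in> space exp_gaps"
    have "emeasure (distr M ?N ?Z) (Pair y -` ?B) = emeasure M (?Z -` (Pair y -` ?B) \<inter> space M)"
      by (rule emeasure_distr[OF Zm sets_Pair1[OF B_sets]])
    also have "?Z -` (Pair y -` ?B) \<inter> space M = {\<omega> \<in> space M. \<forall>i<n. ?S y (Suc i) \<le> x \<and> d < y i \<longrightarrow>
      \<not> (\<exists>F\<in>\<F>. \<forall>s\<in>F. hit_after X d s (?S y i) \<omega>)}"
      using y measurable_space[OF Zm] by (auto simp: G space_pair_measure)
    also have "emeasure M \<dots> \<le> ennreal (failure_weight \<gamma> d n x y)"
      unfolding emeasure_eq_measure
      by (intro ennreal_leI survival_given_origin_arrivals[OF P d _ _ _ F \<gamma>]) (use W V pos in auto)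
    finally show "emeasure (distr M ?N ?Z) (Pair y -` ?B) \<le> ennreal (failure_weight \<gamma> d n x y)" .
  qed
  finally show "emeasure M B \<le> (\<integral>\<^sup>+y. ennreal (failure_weight \<gamma> d n x y) \<partial>exp_gaps)" .
qed

section \<open>The decay rate and the first burnout\<close>

lemma ff_phi_eq_inverse_iff:
  assumes "p < 1"
  shows "ff_phi p t = inverse \<gamma> \<longleftrightarrow> t * exp (- ln (1 - p) * (1 - t)) = 1 - \<gamma>"
proof -
  have "t / (1 - p) powr (1 - t) = t * exp (- ln (1 - p) * (1 - t))"
    using assms by (simp add: powr_def exp_minus divide_inverse mult.commute)
  then show ?thesis by (auto simp: ff_phi_def)
qed

text \<open>The equation says that the continuous function \<open>t (1 - p)\<^bsup>-(1 - t)\<^esup>\<close>, which is \<open>0\<close> at \<open>0\<close> and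
\<open>1\<close> at \<open>1\<close>, takes the value \<open>1 - \<gamma>\<close>. This happens in \<open>(0, 1)\<close>, and the solutions in \<open>[0, 1]\<close>
form a compact set, so there is a smallest one. The bound \<open>l < 1\<close> makes the tilted exponential
law of the gaps a probability law.\<close>

lemma ff_phi_smallest_root:
  assumes p: "p < 1" and \<gamma>: "0 < \<gamma>" "\<gamma> < 1"
  obtains l where "0 < l" "l < 1" "ff_phi p l = inverse \<gamma>"
    "\<And>l'. 0 < l' \<Longrightarrow> ff_phi p l' = inverse \<gamma> \<Longrightarrow> l \<le> l'"
proof -
  define k where "k t = t * exp (- ln (1 - p) * (1 - t))" for t :: real
  let ?S = "{t \<in> {0..1}. k t = 1 - \<gamma>}"
  have cont: "continuous_on {0..1} k" unfolding k_def by (intro continuous_intros)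
  have k01: "k 0 = 0" "k 1 = 1" by (simp_all add: k_def)
  have "\<exists>t\<ge>0. t \<le> 1 \<and> k t = 1 - \<gamma>"
    by (rule IVT') (use cont k01 \<gamma> in auto)
  then have ne: "?S \<noteq> {}" by auto
  have "closed ?S" by (rule continuous_closed_preimage_constant[OF cont]) simp
  then have "compact ?S"
    by (rule compact_eq_bounded_closed[THEN iffD2, OF conjI, rotated])
       (rule bounded_subset[of "{0..1}"], auto)
  from compact_attains_inf[OF this ne] obtain l where l: "l \<in> ?S" "\<And>t. t \<in> ?S \<Longrightarrow> l \<le> t"
    by blast
  have "l \<noteq> 0" "l \<noteq> 1" using l(1) k01 \<gamma> by auto
  show ?thesis
  proof
    show "0 < l" "l < 1" using l(1) \<open>l \<noteq> 0\<close> \<open>l \<noteq> 1\<close> by auto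
    show "ff_phi p l = inverse \<gamma>"
      using l(1) by (simp add: ff_phi_eq_inverse_iff[OF p] k_def)
    fix l' assume l': "0 < l'" "ff_phi p l' = inverse \<gamma>"
    then have "k l' = 1 - \<gamma>" by (simp add: ff_phi_eq_inverse_iff[OF p] k_def)
    then show "l \<le> l'" using l l'(1) by (cases "l' \<le> 1") auto
  qed
qed

text \<open>At a fire the occupied set contains \<open>v0\<close> and all sites hit since the preceding fire. Sites left
over from earlier only enlarge the cluster that burns.\<close>

lemma ff_burnt_of_hits:
  assumes v0: "v0 \<in> V" and gap: "0 \<le> d" "T v0 k + d < T v0 (Suc k)"
    and F: "F \<in> connection_witnesses V E v0 v"
    and hit: "\<And>s. s \<in> F \<Longrightarrow> \<exists>n\<ge>1. T s n \<in> {T v0 k<..T v0 k + d}"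
  shows "v \<in> ff_burnt V E v0 T k"
proof -
  have "F \<subseteq> V" "v \<in> cluster E (insert v0 F) v0"
    using F by (auto simp: connection_witnesses_def)
  moreover have "s \<in> sites_hit V T (T v0 k) (T v0 (Suc k))" if "s \<in> F" for s
    using hit[OF that] gap \<open>F \<subseteq> V\<close> that by (fastforce simp: sites_hit_def)
  moreover have "v0 \<in> sites_hit V T (T v0 k) (T v0 (Suc k))"
    using v0 gap by (auto simp: sites_hit_def intro!: exI[of _ "Suc k"])
  ultimately show ?thesis
    unfolding ff_burnt_def
    using cluster_mono[of "insert v0 F" "ff_after V E v0 T k \<union> sites_hit V T (T v0 k) (T v0 (Suc k))" E v0]
    by auto
qed

theorem theorem3:
  fixes V :: "'v set" and E :: "'v \<Rightarrow> 'v \<Rightarrow> bool" and v0 v :: 'v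
    and M :: "'w measure" and X :: "'v \<Rightarrow> nat \<Rightarrow> 'w \<Rightarrow> real"
    and p \<gamma> :: real
  assumes "simple_graph V E" and "v0 \<in> V"
    and "graph_connected V E" and "graph_locally_finite V E" and "graph_transitive V E v0"
    and "critical_point V E v0 < 1"
    and "at_most_one_infinite_cluster V E"
    and "poisson_arrivals M V X"
    and "v \<in> V"
    and "critical_point V E v0 < p" and "p < 1"
    and "\<gamma> = 1 - (percolation_prob V E v0 p)\<^sup>2 / p"
  shows "0 < \<gamma> \<and> \<gamma> < 1 \<and>
    (\<exists>l>0. ff_phi p l = inverse \<gamma> \<and> (\<forall>l'>0. ff_phi p l' = inverse \<gamma> \<longrightarrow> l \<le> l') \<and>
      (\<forall>x>0. measure M {\<omega> \<in> space M. first_burnout V E v0 (arrival_time X \<omega>) v > ereal x}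
          \<le> inverse \<gamma> * (x * (1 - p) + 1) * exp (- l * x)))"
proof -
  note P = \<open>poisson_arrivals M V X\<close>
  interpret prob_space M using P by (simp add: poisson_arrivals_def)
  have V: "countable V"
    using assms by (intro countable_connected_locally_finite[of V E v0])
  let ?\<theta> = "percolation_prob V E v0"
  have \<theta>0: "0 \<le> ?\<theta> q" for q by (simp add: percolation_prob_def)
  have bdd: "bdd_above {q \<in> {0..1}. ?\<theta> q = 0}" by (rule bdd_above_mono[of "{0..1}"]) auto
  have "?\<theta> 0 = 0"
    using percolation_prob_le[OF V \<open>v0 \<in> V\<close>, of 0 E] \<theta>0[of 0] by simp
  then have "0 \<le> critical_point V E v0"
    unfolding critical_point_def by (intro cSup_upper bdd) auto
  then have p: "0 < p" "p < 1" using assms by auto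
  have "?\<theta> p \<noteq> 0"
  proof
    assume "?\<theta> p = 0"
    then have "p \<le> critical_point V E v0"
      unfolding critical_point_def using p by (intro cSup_upper bdd) auto
    then show False using \<open>critical_point V E v0 < p\<close> by simp
  qed
  then have \<theta>: "0 < ?\<theta> p" "?\<theta> p \<le> p"
    using \<theta>0[of p] percolation_prob_le[OF V \<open>v0 \<in> V\<close>, of p E] p by auto
  have "(?\<theta> p)\<^sup>2 \<le> p * p" unfolding power2_eq_square using \<theta> p by (intro mult_mono) auto
  also have "\<dots> < p * 1" using p by (intro mult_strict_left_mono) auto
  finally have "(?\<theta> p)\<^sup>2 / p < 1" using p by simp
  moreover have "0 < (?\<theta> p)\<^sup>2 / p" using \<theta> p by simp
  ultimately have \<gamma>: "0 < \<gamma>" "\<gamma> < 1" using assms(12) by linarith+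
  obtain l where l: "0 < l" "l < 1" "ff_phi p l = inverse \<gamma>"
    and least: "\<And>l'. 0 < l' \<Longrightarrow> ff_phi p l' = inverse \<gamma> \<Longrightarrow> l \<le> l'"
    using ff_phi_smallest_root[OF p(2) \<gamma>] by blast
  \<comment> \<open>the time by which a site has been hit with probability \<open>p\<close>\<close>
  define d where "d = - ln (1 - p)"
  have d: "0 \<le> d" and ed: "1 - exp (- d) = p" using p by (auto simp: d_def)
  have tilt: "(\<integral>\<^sup>+u. ennreal ((if d < u then \<gamma> else 1) * exp (l * u)) \<partial>std_exp) = 1"
  proof (rule nn_integral_tilted_weight[OF l(2) d])
    have "l * exp (d * (1 - l)) = 1 - \<gamma>"
      using l(3) by (simp add: ff_phi_eq_inverse_iff[OF p(2)] d_def)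
    then have "(1 - \<gamma>) * exp (- (1 - l) * d) = l * (exp (d * (1 - l)) * exp (- (1 - l) * d))"
      by simp
    also have "exp (d * (1 - l)) * exp (- (1 - l) * d) = 1"
      by (simp add: exp_add[symmetric] algebra_simps)
    finally show "l = (1 - \<gamma>) * exp (- (1 - l) * d)" by simp
  qed (use \<gamma> in auto)
  let ?W = "V - {v0}" and ?F = "connection_witnesses V E v0 v"
  have W: "?W \<noteq> {}"
  proof
    assume "?W = {}"
    then have "V \<subseteq> {v0}" by auto
    then have "occupied_sites V \<omega> \<subseteq> {v0}" for \<omega> by (auto simp: occupied_sites_def)
    then have "cluster E (occupied_sites V \<omega>) v0 \<subseteq> {v0}" for \<omega>
      using cluster_subset by (rule subset_trans[rotated])
    then have "finite (cluster E (occupied_sites V \<omega>) v0)" for \<omega>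
      by (rule finite_subset) simp
    then have "?\<theta> p = 0" by (simp add: percolation_prob_def)
    with \<theta> show False by simp
  qed
  have Fsub: "?F \<subseteq> {F. finite F \<and> F \<subseteq> ?W}" by (auto simp: connection_witnesses_def)
  have conn: "1 - measure (site_percolation ?W (1 - exp (- d))) (contains_some ?W (1 - exp (- d)) ?F) \<le> \<gamma>"
    unfolding ed
    using connection_prob_ge[OF V \<open>v0 \<in> V\<close> \<open>v \<in> V\<close> assms(5,7) p(1)] p(2) assms(12) by simp
  have bound: "prob {\<omega> \<in> space M. first_burnout V E v0 (arrival_time X \<omega>) v > ereal x}
      \<le> inverse \<gamma> * exp (- l * x)" if x: "0 < x" for x
  proof -
    let ?A = "{\<omega> \<in> space M. first_burnout V E v0 (arrival_time X \<omega>) v > ereal x}"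
    \<comment> \<open>only the first \<open>n\<close> fires are used; letting \<open>n\<close> tend to infinity removes the error term\<close>
    have le: "prob ?A \<le> inverse \<gamma> * exp (- l * x) + exp x * (1 / 2) ^ n" for n
    proof -
      define B where "B = {\<omega> \<in> space M. \<forall>i<n. arrival_time X \<omega> v0 (Suc i) \<le> x \<and> d < X v0 i \<omega> \<longrightarrow>
        \<not> (\<exists>F\<in>?F. \<forall>s\<in>F. hit_after X d s (arrival_time X \<omega> v0 i) \<omega>)}"
      have "?A \<subseteq> B"
      proof (rule subsetI)
        fix \<omega> assume \<omega>: "\<omega> \<in> ?A"
        let ?T = "arrival_time X \<omega>"
        have False if i: "?T v0 (Suc i) \<le> x" "d < X v0 i \<omega>" and F: "F \<in> ?F"
          and hit: "\<forall>s\<in>F. hit_after X d s (?T v0 i) \<omega>" for i F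
        proof -
          have "v \<in> ff_burnt V E v0 ?T i"
            using i(2) hit by (intro ff_burnt_of_hits[OF \<open>v0 \<in> V\<close> d _ F])
              (auto simp: arrival_time_def hit_after_def)
          then have "first_burnout V E v0 ?T v \<le> ereal (?T v0 (Suc i))"
            unfolding first_burnout_def by (intro INF_lower) simp
          also have "\<dots> \<le> ereal x" using i(1) by simp
          finally show False using \<omega> by (auto dest: leD)
        qed
        then show "\<omega> \<in> B" using \<omega> by (auto simp: B_def)
      qed
      moreover have "B \<in> sets M"
        unfolding B_def by (rule survival_probability_le(1)[OF P d \<open>v0 \<in> V\<close> V refl W Fsub conn])
      ultimately have "prob ?A \<le> prob B" by (rule finite_measure_mono)
      moreover have "ennreal (prob B) \<le> ennreal (inverse \<gamma> * exp (- l * x) + exp x * (1 / 2) ^ n)"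
      proof -
        have "ennreal (prob B) = emeasure M B" by (simp add: emeasure_eq_measure)
        also have "\<dots> \<le> (\<integral>\<^sup>+y. ennreal (failure_weight \<gamma> d n x y) \<partial>exp_gaps)"
          unfolding B_def by (rule survival_probability_le(2)[OF P d \<open>v0 \<in> V\<close> V refl W Fsub conn])
        also have "\<dots> \<le> ennreal (inverse \<gamma> * exp (- l * x) + exp x * (1 / 2) ^ n)"
          using \<gamma> l x by (intro expected_failure_weight_le tilt) auto
        finally show ?thesis .
      qed
      ultimately show ?thesis
        using \<gamma> by (subst (asm) ennreal_le_iff) auto
    qed
    have "(\<lambda>n. inverse \<gamma> * exp (- l * x) + exp x * (1 / 2) ^ n) \<longlonglongrightarrow> inverse \<gamma> * exp (- l * x) + exp x * 0"
      by (intro tendsto_intros LIMSEQ_realpow_zero) auto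
    then show ?thesis
      using le by (intro LIMSEQ_le_const) auto
  qed
  have "prob {\<omega> \<in> space M. first_burnout V E v0 (arrival_time X \<omega>) v > ereal x}
      \<le> inverse \<gamma> * (x * (1 - p) + 1) * exp (- l * x)" if x: "0 < x" for x
  proof -
    \<comment> \<open>the linear factor is at least \<open>1\<close>\<close>
    have "inverse \<gamma> * 1 * exp (- l * x) \<le> inverse \<gamma> * (x * (1 - p) + 1) * exp (- l * x)"
      using \<gamma> p x by (intro mult_right_mono mult_left_mono) auto
    then show ?thesis using bound[OF x] by simp
  qed
  then show ?thesis
    using \<gamma> l least by blast
qed

end
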